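(* Let $\ell$ be a fixed positive integer. Then $$\#\{n\le x: T^{(\ell)}(n)=n\}=o(x)\qquad(x\to\infty),$$ where $n$ ranges over positive integers for which $T^{(\ell)}(n)$ is defined. In particular, for every fixed $\ell$, the set of periodic points of $T$ of exact period $\ell$ has asymptotic density zero.
   Context: The Dedekind psi function is $\psi(n)=n\prod_{p\mid n}\left(1+\frac1p\right)$ for positive integers $n$ (product over primes $p$ dividing $n$), and $T(n):=\psi(n)-n$. Put $T^{(0)}(n)=n$ and $T^{(j+1)}(n)=T\bigl(T^{(j)}(n)\bigr)$ whenever $T^{(j)}(n)$ is a positive integer (note $T(1)=0$, so an orbit may terminate at $0$). A positive integer $n$ is a periodic point of $T$ if $T^{(r)}(n)=n$ for some positive integer $r$ for which the relevant iterates are defined; the least such $r$ is the exact period of $n$. The asymptotic density of a set $A$ of positive integers is $d(A)=\lim_{x\to\infty}\frac1x\#\{n\le x:n\in A\}$ when the limit exists. *)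

theory Defs
  imports "HOL-Library.Landau_Symbols" "HOL-Computational_Algebra.Primes"
begin

definition dedekind_psi :: "nat \<Rightarrow> real" where
  "dedekind_psi n = real n * (\<Prod>p\<in>prime_factors n. 1 + 1 / real p)"

text \<open>
  The value \<open>dedekind_psi n - real n\<close> is always a natural number, so the rounding below
  changes nothing; see \<open>of_nat_T\<close>.
\<close>

definition T :: "nat \<Rightarrow> nat" where
  "T n = nat \<lfloor>dedekind_psi n - real n\<rfloor>"

text \<open>The iterate is \<open>None\<close> where it is undefined: \<open>T\<close> is only applied to positive integers.\<close>

fun T_iter :: "nat \<Rightarrow> nat \<Rightarrow> nat option" where
  "T_iter 0 n = Some n"
| "T_iter (Suc j) n =
     (case T_iter j n of
        None \<Rightarrow> None
      | Some m \<Rightarrow> if m > 0 then Some (T m) else None)"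

definition periodic_point :: "nat \<Rightarrow> bool" where
  "periodic_point n \<longleftrightarrow> n > 0 \<and> (\<exists>r>0. T_iter r n = Some n)"

definition exact_period :: "nat \<Rightarrow> nat" where
  "exact_period n = (LEAST r. r > 0 \<and> T_iter r n = Some n)"

definition has_asymptotic_density :: "nat set \<Rightarrow> real \<Rightarrow> bool" where
  "has_asymptotic_density A d \<longleftrightarrow>
     ((\<lambda>x::real. real (card {n. 0 < n \<and> real n \<le> x \<and> n \<in> A}) / x) \<longlongrightarrow> d) at_top"

lemma prod_prime_factors_dvd:
  fixes n :: nat
  assumes "n > 0"
  shows "\<Prod>(prime_factors n) dvd n"
proof -
  have "prod_mset (mset_set (prime_factors n)) dvd prod_mset (prime_factorization n)"
    by (intro prod_mset_subset_imp_dvd mset_set_set_mset_msubset)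
  with assms show ?thesis
    by (simp add: prod_mset_prime_factorization_nat prod_unfold_prod_mset)
qed

lemma dedekind_psi_nat:
  obtains m where "dedekind_psi n = real m" "n \<le> m"
proof (cases "n = 0")
  case True
  then show ?thesis using that[of 0] by (simp add: dedekind_psi_def)
next
  case False
  define P where "P = \<Prod>(prime_factors n)"
  obtain k where k: "n = P * k"
    using prod_prime_factors_dvd[of n] False unfolding P_def by (auto elim: dvdE)
  have pos: "p > 0" if "p \<in> prime_factors n" for p
    using that by (simp add: in_prime_factors_iff prime_gt_0_nat)
  have "real P * (\<Prod>p\<in>prime_factors n. 1 + 1 / real p) = (\<Prod>p\<in>prime_factors n. real p * (1 + 1 / real p))"
    by (simp add: P_def prod.distrib)
  also have "\<dots> = (\<Prod>p\<in>prime_factors n. real (p + 1))"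
    using pos by (intro prod.cong) (auto simp: field_simps)
  finally have "dedekind_psi n = real (k * (\<Prod>p\<in>prime_factors n. p + 1))"
    unfolding dedekind_psi_def by (subst (1) k) (simp add: mult.assoc mult.left_commute)
  moreover have "P \<le> (\<Prod>p\<in>prime_factors n. p + 1)"
    unfolding P_def by (intro prod_mono) auto
  ultimately show ?thesis
    using that[of "k * (\<Prod>p\<in>prime_factors n. p + 1)"] k by (metis mult.commute mult_le_mono1)
qed

lemma of_nat_T: "real (T n) = dedekind_psi n - real n"
proof -
  obtain m where m: "dedekind_psi n = real m" "n \<le> m" by (rule dedekind_psi_nat)
  then have "dedekind_psi n - real n = real (m - n)" by simp
  then show ?thesis unfolding T_def by simp
qed

end

theory Submission
  imports Defs
    "HOL-Number_Theory.Residue_Primitive_Roots"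
    "HOL-Number_Theory.Prime_Powers"
    "HOL-Computational_Algebra.Squarefree"
begin

text \<open>
  Let \<open>m\<close> be the least element of a cycle of length \<open>l\<close>. Then \<open>T m \<ge> m\<close>, that is,
  \<open>\<psi>(m) / m \<ge> 2\<close>. Outside a set of small density, already the primes \<open>p \<le> y\<close> dividing \<open>m\<close>
  push this ratio strictly above 2, because the values \<open>\<psi>(n) / n\<close> do not concentrate near 2.
  Moreover, for almost all \<open>n\<close> the small primes dividing \<open>n\<close> divide all of \<open>T n, \<dots>, T\<^sup>l n\<close>:
  if \<open>q\<close> and \<open>p \<equiv> -1 (mod q)\<close> are primes dividing \<open>n\<close>, then \<open>q\<close> divides \<open>\<psi>(n)\<close> and hence \<open>T n\<close>,
  and such a \<open>p\<close> can be chosen from a fixed finite set for almost all \<open>n\<close>, since the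
  reciprocals of the primes \<open>\<equiv> -1 (mod q)\<close> have a divergent sum. Hence the ratio stays above 2 along
  the whole orbit, the orbit of \<open>m\<close> increases strictly, and it cannot return to \<open>m\<close>. So the cycle
  minima have density zero, and with them all elements of cycles of length \<open>l\<close>.

  The divergence is proved by Shapiro's elementary method for prime moduli, with Monsky's Lambert
  series argument for the nonvanishing of \<open>L(1, \<chi>)\<close> at the real character.
\<close>

section \<open>Sums over divisors\<close>

lemma sum_upto_sum_divisors:
  fixes F :: "nat \<Rightarrow> nat \<Rightarrow> 'a::comm_monoid_add"
  shows "(\<Sum>n=1..N. \<Sum>d | d dvd n. F d (n div d)) = (\<Sum>d=1..N. \<Sum>e=1..N div d. F d e)"
proof -
  have left_factor_le: "b \<le> N" if "b * k \<le> N" "0 < k" for b k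
    using that by (metis One_nat_def Suc_leI le_trans mult.right_neutral mult_le_mono2)
  have "(\<Sum>n=1..N. \<Sum>d | d dvd n. F d (n div d)) =
        (\<Sum>(n,d)\<in>(SIGMA n:{1..N}. {d. d dvd n}). F d (n div d))"
    by (rule sum.Sigma) (auto intro: finite_divisors_nat)
  also have "\<dots> = (\<Sum>(d,e)\<in>(SIGMA d:{1..N}. {1..N div d}). F d e)"
    by (rule sum.reindex_bij_witness[where i = "\<lambda>(d,e). (d * e, d)" and j = "\<lambda>(n,d). (d, n div d)"])
       (auto simp: div_le_mono less_eq_div_iff_mult_less_eq Suc_le_eq mult.commute
             dest: dvd_imp_le intro: Nat.gr0I left_factor_le elim!: dvdE)
  also have "\<dots> = (\<Sum>d=1..N. \<Sum>e=1..N div d. F d e)"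
    by (rule sum.Sigma [symmetric]) auto
  finally show ?thesis .
qed

lemma sum_divisors_swap:
  fixes F :: "nat \<Rightarrow> nat \<Rightarrow> 'a::comm_monoid_add"
  assumes "n > 0"
  shows "(\<Sum>d | d dvd n. \<Sum>e | e dvd n div d. F d e) = (\<Sum>e | e dvd n. \<Sum>d | d dvd n div e. F d e)"
proof -
  have factor_pairs: "(SIGMA d:{d. d dvd n}. {e. e dvd n div d}) = {(d,e). d * e dvd n}"
    using assms by (auto simp: dvd_div_iff_mult mult.commute dest: dvd_mult_left dvd_mult_right)
  have finite_cofactors: "finite {e. e dvd n div d}" if "d dvd n" for d
    using that assms by (intro finite_divisors_nat) (auto simp: dvd_div_eq_0_iff intro!: Nat.gr0I)
  have as_pairs: "(\<Sum>d | d dvd n. \<Sum>e | e dvd n div d. G d e) = (\<Sum>(d,e)\<in>{(d,e). d * e dvd n}. G d e)"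
    for G :: "nat \<Rightarrow> nat \<Rightarrow> 'a"
    unfolding factor_pairs[symmetric] using assms finite_cofactors by (intro sum.Sigma) auto
  show ?thesis
    unfolding as_pairs[of F] as_pairs[of "\<lambda>e d. F d e"]
    by (rule sum.reindex_bij_witness[where i = prod.swap and j = prod.swap]) (auto simp: mult.commute)
qed

lemma sum_divisors_prime_power_mult:
  fixes f :: "nat \<Rightarrow> 'a::comm_monoid_add"
  assumes prime: "prime p" and not_dvd: "\<not> p dvd m"
  shows "(\<Sum>d | d dvd p ^ k * m. f d) = (\<Sum>i\<le>k. \<Sum>d | d dvd m. f (p ^ i * d))"
proof -
  have m_pos: "m > 0" using not_dvd by (auto intro: Nat.gr0I)
  have multiplicity: "multiplicity p (p ^ i * d) = i" if "d dvd m" for i d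
  proof -
    have "\<not> p dvd d" "d > 0" using that not_dvd m_pos by (auto dest: dvd_trans intro: Nat.gr0I)
    then show ?thesis
      using prime by (simp add: prime_elem_multiplicity_mult_distrib not_dvd_imp_multiplicity_0)
  qed
  have inj: "inj_on (\<lambda>(i,d). p ^ i * d) ({..k} \<times> {d. d dvd m})"
  proof (rule inj_onI, clarsimp)
    fix i d j e assume same_image: "d dvd m" "e dvd m" "p ^ i * d = p ^ j * e"
    then have "i = j" by (metis multiplicity)
    with same_image prime show "i = j \<and> d = e" by auto
  qed
  have image: "(\<lambda>(i,d). p ^ i * d) ` ({..k} \<times> {d. d dvd m}) = {d. d dvd p ^ k * m}"
  proof (intro equalityI subsetI)
    fix x assume "x \<in> {d. d dvd p ^ k * m}"
    then obtain a b where "x = a * b" "a dvd p ^ k" "b dvd m"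
      using division_decomp by blast
    moreover from this prime obtain i where "a = p ^ i" "i \<le> k"
      by (auto simp: divides_primepow_nat)
    ultimately show "x \<in> (\<lambda>(i,d). p ^ i * d) ` ({..k} \<times> {d. d dvd m})"
      by (intro image_eqI[of _ _ "(i, b)"]) auto
  qed (auto intro: mult_dvd_mono le_imp_power_dvd)
  have "(\<Sum>i\<le>k. \<Sum>d | d dvd m. f (p ^ i * d)) = (\<Sum>(i,d)\<in>{..k} \<times> {d. d dvd m}. f (p ^ i * d))"
    using m_pos by (intro sum.Sigma) (auto simp: finite_divisors_nat)
  also have "\<dots> = (\<Sum>d | d dvd p ^ k * m. f d)"
    unfolding image[symmetric] by (subst sum.reindex[OF inj]) (simp add: case_prod_unfold o_def)
  finally show ?thesis ..
qed

lemma prime_power_decomposition_nat: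
  fixes n :: nat
  assumes "n > 1"
  obtains p k m where "prime p" "k > 0" "\<not> p dvd m" "n = p ^ k * m" "m < n" "m > 0"
proof -
  obtain p where prime_p: "prime p" "p dvd n" using assms prime_factor_nat[of n] by auto
  obtain m where cofactor: "n = p ^ multiplicity p n * m" "\<not> p dvd m"
    using multiplicity_decompose'[of n p] assms prime_p by (metis not_prime_unit gr_implies_not0)
  have mult_pos: "multiplicity p n > 0"
    using prime_p assms by (simp add: prime_multiplicity_gt_zero_iff)
  have m_pos: "m > 0" using cofactor assms by (auto intro: Nat.gr0I)
  have "1 < p ^ multiplicity p n"
    using prime_p mult_pos prime_gt_1_nat[of p] by (intro one_less_power) auto
  then have "m < n" using m_pos by (subst cofactor(1)) simp
  with that prime_p mult_pos cofactor m_pos show ?thesis by blast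
qed

section \<open>The Moebius function\<close>

definition moebius :: "nat \<Rightarrow> 'a::comm_ring_1" where
  "moebius n = (if squarefree n then (- 1) ^ card (prime_factors n) else 0)"

lemma norm_moebius_le: "norm (moebius n :: 'a::{comm_ring_1,real_normed_algebra_1}) \<le> 1"
  by (auto simp: moebius_def norm_power intro: order_trans[OF norm_power_ineq])

lemma moebius_1 [simp]: "moebius (Suc 0) = 1"
  by (simp add: moebius_def)

lemma moebius_prime_mult:
  assumes "prime p" "\<not> p dvd d"
  shows "moebius (p * d) = - moebius d"
proof -
  have d_pos: "d > 0" using assms by (auto intro: Nat.gr0I)
  have "coprime p d" using assms by (simp add: prime_imp_coprime)
  then have "squarefree (p * d) \<longleftrightarrow> squarefree d"
    using assms by (meson squarefree_mult_coprime squarefree_multD(2) squarefree_prime)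
  moreover have "prime_factors (p * d) = insert p (prime_factors d)"
    using assms d_pos by (simp add: prime_factors_product prime_prime_factors)
  moreover have "p \<notin> prime_factors d" using assms by auto
  ultimately show ?thesis by (simp add: moebius_def)
qed

lemma moebius_prime_power_mult: "prime p \<Longrightarrow> moebius (p ^ Suc (Suc i) * d) = 0"
  unfolding moebius_def squarefree_def
  by (auto simp: power2_eq_square dest!: spec[of _ p] intro: dvd_mult2)

lemma sum_moebius_divisors:
  assumes "n > 0"
  shows "(\<Sum>d | d dvd n. moebius d :: 'a::comm_ring_1) = of_bool (n = 1)"
proof (cases "n = 1")
  case True
  then show ?thesis by simp
next
  case False
  then have "n > 1" using assms by simp
  then obtain p k m where decomposition: "prime p" "k > 0" "\<not> p dvd m" "n = p ^ k * m"
    using prime_power_decomposition_nat by metis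
  have "(\<Sum>d | d dvd n. moebius d :: 'a) = (\<Sum>i\<le>k. \<Sum>d | d dvd m. moebius (p ^ i * d))"
    unfolding \<open>n = _\<close> by (rule sum_divisors_prime_power_mult) fact+
  also have "\<dots> = (\<Sum>i\<in>{0,1}. \<Sum>d | d dvd m. moebius (p ^ i * d))"
  proof (intro sum.mono_neutral_right ballI)
    fix i assume "i \<in> {..k} - {0, 1}"
    then have "i = Suc (Suc (i - 2))" by auto
    then have "moebius (p ^ i * d) = (0::'a)" for d
      using moebius_prime_power_mult[of p "i - 2" d] decomposition by simp
    then show "(\<Sum>d | d dvd m. moebius (p ^ i * d)) = (0::'a)" by simp
  qed (use \<open>k > 0\<close> in auto)
  also have "\<dots> = (\<Sum>d | d dvd m. moebius d) + (\<Sum>d | d dvd m. moebius (p * d))" by simp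
  also have "(\<Sum>d | d dvd m. moebius (p * d) :: 'a) = (\<Sum>d | d dvd m. - moebius d)"
    using decomposition by (intro sum.cong moebius_prime_mult) (auto dest: dvd_trans)
  finally show ?thesis using False by (simp add: sum_negf)
qed

lemma moebius_inversion:
  fixes f g :: "nat \<Rightarrow> 'a::comm_ring_1"
  assumes g_eq: "\<And>m. m > 0 \<Longrightarrow> g m = (\<Sum>d | d dvd m. f d)" and n_pos: "n > 0"
  shows "(\<Sum>d | d dvd n. moebius d * g (n div d)) = f n"
proof -
  have cofactor_pos: "n div d > 0" if "d dvd n" for d
    using that n_pos by (auto simp: dvd_div_eq_0_iff intro!: Nat.gr0I)
  have "(\<Sum>d | d dvd n. moebius d * g (n div d)) = (\<Sum>d | d dvd n. \<Sum>e | e dvd n div d. moebius d * f e)"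
    using cofactor_pos by (intro sum.cong refl) (simp add: g_eq sum_distrib_left)
  also have "\<dots> = (\<Sum>e | e dvd n. \<Sum>d | d dvd n div e. moebius d * f e)"
    by (rule sum_divisors_swap[OF n_pos])
  also have "\<dots> = (\<Sum>e | e dvd n. (\<Sum>d | d dvd n div e. moebius d) * f e)"
    by (simp only: sum_distrib_right)
  also have "\<dots> = (\<Sum>e | e dvd n. if e = n then f n else 0)"
  proof (intro sum.cong refl)
    fix e assume "e \<in> {e. e dvd n}"
    moreover from this have "n div e = 1 \<longleftrightarrow> e = n" using n_pos by (auto elim!: dvdE)
    ultimately show "(\<Sum>d | d dvd n div e. moebius d) * f e = (if e = n then f n else 0)"
      using cofactor_pos by (simp add: sum_moebius_divisors)
  qed
  also have "\<dots> = f n" using n_pos by (simp add: finite_divisors_nat)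
  finally show ?thesis .
qed

section \<open>Partial summation\<close>

lemma norm_sum_antimono_le:
  fixes c :: "nat \<Rightarrow> 'a::real_normed_vector" and w :: "nat \<Rightarrow> real"
  assumes bounded: "\<And>n. norm (\<Sum>k=m..<n. c k) \<le> B"
    and antimono: "\<And>k. k \<ge> m \<Longrightarrow> w (Suc k) \<le> w k" and nonneg: "\<And>k. k \<ge> m \<Longrightarrow> w k \<ge> 0"
  shows "norm (\<Sum>k=m..<n. w k *\<^sub>R c k) \<le> B * w m"
proof (cases "m \<le> n")
  case True
  define S where "S n = (\<Sum>k=m..<n. c k)" for n
  define D where "D n = (\<Sum>k=m..<n. w k *\<^sub>R c k) - w n *\<^sub>R S n" for n
  have norm_S_le: "norm (S n) \<le> B" for n using bounded by (simp add: S_def)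
  have "norm (D n) \<le> B * (w m - w n)"
    using True
  proof (induction n rule: dec_induct)
    case base
    show ?case by (simp add: D_def S_def)
  next
    case (step n)
    have "D (Suc n) = D n + (w n - w (Suc n)) *\<^sub>R S (Suc n)"
      using step by (simp add: D_def S_def algebra_simps)
    then have "norm (D (Suc n)) \<le> norm (D n) + (w n - w (Suc n)) * norm (S (Suc n))"
      using antimono[of n] step norm_triangle_ineq[of "D n" "(w n - w (Suc n)) *\<^sub>R S (Suc n)"] by simp
    also have "\<dots> \<le> B * (w m - w n) + (w n - w (Suc n)) * B"
      using step norm_S_le antimono[of n] by (intro add_mono mult_left_mono) auto
    finally show ?case by (simp add: algebra_simps)
  qed
  moreover have "norm (w n *\<^sub>R S n) \<le> w n * B"
    using norm_S_le nonneg[OF True] by (simp add: mult_left_mono)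
  moreover have "(\<Sum>k=m..<n. w k *\<^sub>R c k) = D n + w n *\<^sub>R S n" by (simp add: D_def)
  ultimately show ?thesis
    using norm_triangle_ineq[of "D n" "w n *\<^sub>R S n"] by (simp add: algebra_simps)
next
  case False
  then show ?thesis using bounded[of m] nonneg[of m] by simp
qed

lemma dirichlet_test:
  fixes c :: "nat \<Rightarrow> 'a::banach" and w :: "nat \<Rightarrow> real"
  assumes bounded: "\<And>m n. norm (\<Sum>k=m..<n. c k) \<le> B"
    and antimono: "\<And>k. k \<ge> m0 \<Longrightarrow> w (Suc k) \<le> w k" and nonneg: "\<And>k. k \<ge> m0 \<Longrightarrow> w k \<ge> 0"
    and lim: "w \<longlonglongrightarrow> 0"
  shows summable_dirichlet_test: "summable (\<lambda>k. w k *\<^sub>R c k)"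
    and norm_dirichlet_tail_le:
      "m \<ge> m0 \<Longrightarrow> norm ((\<Sum>k<m. w k *\<^sub>R c k) - (\<Sum>k. w k *\<^sub>R c k)) \<le> B * w m"
proof -
  define t where "t k = w k *\<^sub>R c k" for k
  have tail: "norm (sum t {m..<n}) \<le> B * w m" if "m \<ge> m0" for m n
    unfolding t_def using that by (intro norm_sum_antimono_le bounded antimono nonneg) auto
  have "summable t"
    unfolding summable_Cauchy
  proof (intro allI impI)
    fix e :: real assume "e > 0"
    moreover have "(\<lambda>m. B * w m) \<longlonglongrightarrow> 0" using lim by (rule tendsto_mult_right_zero)
    ultimately have "eventually (\<lambda>m. B * w m < e) sequentially" by (intro order_tendstoD(2)) auto
    then have "eventually (\<lambda>m. \<forall>n. norm (sum t {m..<n}) < e) sequentially"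
      using eventually_ge_at_top[of m0] by eventually_elim (auto intro: le_less_trans[OF tail])
    then show "\<exists>M. \<forall>m\<ge>M. \<forall>n. norm (sum t {m..<n}) < e" by (simp add: eventually_sequentially)
  qed
  then show "summable (\<lambda>k. w k *\<^sub>R c k)" unfolding t_def .
  show "norm ((\<Sum>k<m. w k *\<^sub>R c k) - (\<Sum>k. w k *\<^sub>R c k)) \<le> B * w m" if "m \<ge> m0" for m
  proof (rule tendsto_upperbound)
    have "(\<lambda>n. sum t {..<n}) \<longlonglongrightarrow> suminf t" using \<open>summable t\<close> by (rule summable_LIMSEQ)
    then show "(\<lambda>n. norm (sum t {..<m} - sum t {..<n})) \<longlonglongrightarrow>
      norm ((\<Sum>k<m. w k *\<^sub>R c k) - (\<Sum>k. w k *\<^sub>R c k))"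
      unfolding t_def by (intro tendsto_intros)
    show "eventually (\<lambda>n. norm (sum t {..<m} - sum t {..<n}) \<le> B * w m) sequentially"
      using eventually_ge_at_top[of m]
    proof eventually_elim
      case (elim n)
      then have "sum t {..<n} = sum t {..<m} + sum t {m..<n}"
        by (simp add: sum.atLeastLessThan_concat flip: atLeast0LessThan)
      then show ?case using tail[OF that] by simp
    qed
  qed simp
qed

section \<open>Chebyshev and Mertens estimates\<close>

lemma ln_fact_conv_sum: "ln (fact N) = (\<Sum>n=1..N. ln (real n))"
  by (induction N) (simp_all add: ln_mult)

lemma sum_mangoldt_div:
  assumes "N \<le> D"
  shows "(\<Sum>d=1..D. mangoldt d * real (N div d)) = ln (fact N)"
proof -
  have "ln (fact N) = (\<Sum>n=1..N. \<Sum>d | d dvd n. mangoldt d :: real)"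
    unfolding ln_fact_conv_sum by (intro sum.cong) (simp_all add: mangoldt_sum)
  also have "\<dots> = (\<Sum>d=1..N. \<Sum>e=1..N div d. mangoldt d)"
    by (rule sum_upto_sum_divisors)
  also have "\<dots> = (\<Sum>d=1..N. mangoldt d * real (N div d))" by (simp add: mult.commute)
  also have "\<dots> = (\<Sum>d=1..D. mangoldt d * real (N div d))"
    using assms by (intro sum.mono_neutral_left) auto
  finally show ?thesis ..
qed

lemma sum_mangoldt_eq_ln_central_binomial:
  "(\<Sum>d=1..2 * n. mangoldt d * (real (2 * n div d) - 2 * real (n div d))) = ln (real (2 * n choose n))"
proof -
  have "(\<Sum>d=1..2 * n. mangoldt d * (real (2 * n div d) - 2 * real (n div d))) =
        (\<Sum>d=1..2 * n. mangoldt d * real (2 * n div d)) -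
        2 * (\<Sum>d=1..2 * n. mangoldt d * real (n div d))"
    by (simp add: right_diff_distrib sum_subtractf sum_distrib_left mult.left_commute)
  also have "\<dots> = ln (fact (2 * n)) - 2 * ln (fact n)"
    by (simp only: sum_mangoldt_div[of "2 * n" "2 * n"] sum_mangoldt_div[of n "2 * n"])
  also have "\<dots> = ln (fact (2 * n) / (fact n * fact n))"
    by (simp add: ln_div ln_mult)
  also have "fact (2 * n) / (fact n * fact n) = real (2 * n choose n)"
    using binomial_fact[of n "2 * n", where ?'a = real] by simp
  finally show ?thesis .
qed

lemma sum_mangoldt_dyadic_le: "(\<Sum>d=Suc n..2 * n. mangoldt d) \<le> 2 * real n"
proof -
  have "(\<Sum>d=Suc n..2 * n. mangoldt d) \<le>
        (\<Sum>d=Suc n..2 * n. mangoldt d * (real (2 * n div d) - 2 * real (n div d)))"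
  proof (rule sum_mono)
    fix d assume d_range: "d \<in> {Suc n..2 * n}"
    then have "1 \<le> 2 * n div d" by (simp add: less_eq_div_iff_mult_less_eq)
    moreover have "n div d = 0" using d_range by simp
    ultimately show "mangoldt d \<le> mangoldt d * (real (2 * n div d) - 2 * real (n div d))"
      using mangoldt_nonneg[of d] by (simp add: mult_le_cancel_left1)
  qed
  also have "\<dots> \<le> (\<Sum>d=1..2 * n. mangoldt d * (real (2 * n div d) - 2 * real (n div d)))"
  proof (intro sum_mono2 mult_nonneg_nonneg mangoldt_nonneg)
    fix d
    have "2 * (n div d) \<le> 2 * n div d"
      by (cases "d = 0") (auto simp: less_eq_div_iff_mult_less_eq)
    then show "0 \<le> real (2 * n div d) - 2 * real (n div d)" by linarith
  qed auto
  also have "\<dots> = ln (real (2 * n choose n))" by (rule sum_mangoldt_eq_ln_central_binomial)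
  also have "\<dots> \<le> ln (real (2 ^ (2 * n)))"
    using binomial_le_pow2[of "2 * n" n] by (subst ln_le_cancel_iff) (auto simp flip: of_nat_le_iff)
  also have "\<dots> = 2 * real n * ln 2" by (simp add: ln_realpow)
  also have "\<dots> \<le> 2 * real n * 1" using ln_2_less_1 by (intro mult_left_mono) auto
  finally show ?thesis by simp
qed

lemma sum_mangoldt_le: "(\<Sum>d=1..N. mangoldt d) \<le> 4 * real N"
proof (induction N rule: less_induct)
  case (less N)
  define n where "n = N div 2"
  show ?case
  proof (cases "N = 0")
    case False
    then have halved: "n < N" "N = 2 * n \<or> N = Suc (2 * n)" by (auto simp: n_def)
    have "(\<Sum>d=1..2 * n. mangoldt d :: real) = (\<Sum>d=1..n. mangoldt d) + (\<Sum>d=Suc n..2 * n. mangoldt d)"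
      using sum.ub_add_nat[of 1 n mangoldt n] by (simp add: mult_2)
    also have "\<dots> \<le> 4 * real n + 2 * real n"
      using less.IH[OF halved(1)] sum_mangoldt_dyadic_le by (intro add_mono)
    finally have "(\<Sum>d=1..2 * n. mangoldt d) \<le> 6 * real n" by simp
    moreover have "mangoldt N \<le> real N"
    proof -
      have "mangoldt N \<le> ln (real N)" using False by (intro mangoldt_le) simp
      also have "\<dots> \<le> real N" using ln_le_minus_one[of "real N"] False by simp
      finally show ?thesis .
    qed
    ultimately show ?thesis using halved(2) by auto
  qed simp
qed

lemma ln_fact_ge: "real N * ln (real N) - real N \<le> ln (fact N)"
proof (induction N)
  case (Suc N)
  show ?case
  proof (cases "N = 0")
    case False
    have "ln (real (Suc N)) = ln (real N) + ln (1 + 1 / real N)"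
      using False by (subst ln_mult_pos [symmetric]) (auto simp: distrib_left intro: add_pos_nonneg)
    also have "ln (1 + 1 / real N) \<le> 1 / real N"
      by (rule ln_add_one_self_le_self) auto
    finally have "real N * ln (real (Suc N)) \<le> real N * (ln (real N) + 1 / real N)"
      by (intro mult_left_mono) auto
    also have "\<dots> = real N * ln (real N) + 1" using False by (simp add: distrib_left)
    finally have "real N * ln (real (Suc N)) \<le> ln (fact N) + real N + 1" using Suc by linarith
    moreover have "ln (fact (Suc N) :: real) = ln (real (Suc N)) + ln (fact N)"
      by (simp add: ln_mult)
    ultimately show ?thesis by (simp add: algebra_simps)
  qed simp
qed simp

lemma ln_fact_le: "ln (fact N) \<le> real N * ln (real N)"
proof -
  have "ln (fact N :: real) \<le> ln (real N ^ N)"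
    using fact_le_power[of N, where ?'a = real] by (cases "N = 0") (auto simp: ln_le_cancel_iff)
  then show ?thesis by (cases "N = 0") (auto simp: ln_realpow)
qed

lemma real_divide_le_Suc_div: "d > 0 \<Longrightarrow> real N / real d \<le> real (Suc (N div d))"
  using dividend_less_times_div[of d N]
  by (simp add: divide_le_eq algebra_simps flip: of_nat_mult of_nat_add)

definition mertens_sum :: "(nat \<Rightarrow> 'a::real_normed_field) \<Rightarrow> nat \<Rightarrow> 'a" where
  "mertens_sum \<chi> N = (\<Sum>n=1..N. \<chi> n * mangoldt n / of_nat n)"

lemma mertens_sum_mono:
  fixes f g :: "nat \<Rightarrow> real"
  assumes "\<And>n. f n \<le> g n"
  shows "mertens_sum f N \<le> mertens_sum g N"
  unfolding mertens_sum_def using assms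
  by (intro sum_mono divide_right_mono mult_right_mono mangoldt_nonneg) auto

lemma mertens_sum_nonneg:
  fixes f :: "nat \<Rightarrow> real"
  assumes "\<And>n. f n \<ge> 0"
  shows "mertens_sum f N \<ge> 0"
  unfolding mertens_sum_def using assms by (intro sum_nonneg) (simp add: mangoldt_nonneg)

lemma mertens_sum_add: "mertens_sum (\<lambda>n. f n + g n) N = mertens_sum f N + mertens_sum g N"
  by (simp add: mertens_sum_def distrib_right add_divide_distrib sum.distrib)

lemma mertens_sum_1_ge:
  assumes "N > 0"
  shows "ln (real N) - 1 \<le> mertens_sum (\<lambda>_. 1) N"
proof -
  have "real N * (ln (real N) - 1) \<le> ln (fact N)"
    using ln_fact_ge[of N] by (simp add: algebra_simps)
  also have "\<dots> = (\<Sum>n=1..N. mangoldt n * real (N div n))" by (simp only: sum_mangoldt_div)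
  also have "\<dots> \<le> (\<Sum>n=1..N. mangoldt n * (real N / real n))"
    by (intro sum_mono mult_left_mono mangoldt_nonneg of_nat_div_le_of_nat)
  also have "\<dots> = real N * mertens_sum (\<lambda>_. 1) N"
    by (simp add: mertens_sum_def sum_distrib_left mult_ac)
  finally show ?thesis using assms by simp
qed

lemma mertens_sum_1_le:
  assumes "N > 0"
  shows "mertens_sum (\<lambda>_. 1) N \<le> ln (real N) + 4"
proof -
  have "real N * mertens_sum (\<lambda>_. 1) N = (\<Sum>n=1..N. mangoldt n * (real N / real n))"
    by (simp add: mertens_sum_def sum_distrib_left mult_ac)
  also have "\<dots> \<le> (\<Sum>n=1..N. mangoldt n * (real (N div n) + 1))"
    using real_divide_le_Suc_div
    by (intro sum_mono mult_left_mono mangoldt_nonneg) (auto simp: add.commute)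
  also have "\<dots> = ln (fact N) + (\<Sum>n=1..N. mangoldt n)"
    using sum_mangoldt_div[of N N] by (simp add: distrib_left sum.distrib)
  also have "\<dots> \<le> real N * (ln (real N) + 4)"
    using ln_fact_le[of N] sum_mangoldt_le[of N] unfolding distrib_left by linarith
  finally show ?thesis using assms by simp
qed

lemma sum_power_from_2_le:
  fixes x :: real
  assumes "0 \<le> x" "x \<le> 1 / 2"
  shows "(\<Sum>k=2..N. x ^ k) \<le> 2 * x\<^sup>2"
proof -
  have "(1 - x) * (\<Sum>k=2..N. x ^ k) \<le> x\<^sup>2"
    using assms by (cases "2 \<le> N") (simp_all add: sum_gp_multiplied)
  moreover have "1 / 2 * (\<Sum>k=2..N. x ^ k) \<le> (1 - x) * (\<Sum>k=2..N. x ^ k)"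
    using assms by (intro mult_right_mono sum_nonneg) auto
  ultimately show ?thesis by simp
qed

lemma mertens_sum_nonprime_le:
  "mertens_sum (\<lambda>n. of_bool (\<not> prime n)) N \<le> (\<Sum>p=2..N. ln (real p) * (\<Sum>k=2..N. (1 / real p) ^ k))"
proof -
  define S where "S = {n \<in> {1..N}. \<not> prime n \<and> primepow n}"
  define powers where "powers = {p \<in> {2..N}. prime p} \<times> {2..N}"
  have "mertens_sum (\<lambda>n. of_bool (\<not> prime n)) N = (\<Sum>n\<in>S. of_bool (\<not> prime n) * mangoldt n / real n)"
    unfolding mertens_sum_def by (intro sum.mono_neutral_right) (auto simp: S_def mangoldt_def)
  also have "\<dots> = (\<Sum>n\<in>S. mangoldt n / real n)" by (simp add: S_def)
  also have "\<dots> \<le> (\<Sum>n\<in>(\<lambda>(p,k). p ^ k) ` powers. mangoldt n / real n)"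
  proof (rule sum_mono2)
    show "S \<subseteq> (\<lambda>(p,k). p ^ k) ` powers"
    proof
      fix n assume n_in_S: "n \<in> S"
      then obtain p k where prime_power: "prime p" "k > 0" "n = p ^ k"
        by (auto simp: S_def primepow_def)
      have p_ge_2: "p \<ge> 2" using prime_power prime_ge_2_nat by auto
      have "k \<noteq> 1" using n_in_S prime_power by (auto simp: S_def)
      moreover have "k < p ^ k" by (rule power_gt_expt) (use p_ge_2 in auto)
      moreover have "p \<le> p ^ k" using prime_power p_ge_2 by (intro self_le_power) auto
      ultimately show "n \<in> (\<lambda>(p,k). p ^ k) ` powers"
        using prime_power n_in_S p_ge_2
        by (intro image_eqI[of _ _ "(p, k)"]) (auto simp: S_def powers_def)
    qed
  qed (auto simp: mangoldt_nonneg powers_def)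
  also have "\<dots> \<le> (\<Sum>(p,k)\<in>powers. ln (real p) * (1 / real p) ^ k)"
    by (rule order_trans[OF sum_image_le])
       (auto simp: powers_def mangoldt_nonneg mangoldt_primepow power_one_over intro!: sum_mono)
  also have "\<dots> = (\<Sum>p | p \<in> {2..N} \<and> prime p. \<Sum>k=2..N. ln (real p) * (1 / real p) ^ k)"
    unfolding powers_def by (subst sum.Sigma) auto
  also have "\<dots> \<le> (\<Sum>p=2..N. \<Sum>k=2..N. ln (real p) * (1 / real p) ^ k)"
    by (intro sum_mono2 sum_nonneg mult_nonneg_nonneg) auto
  finally show ?thesis by (simp only: sum_distrib_left)
qed

lemma sum_inverse_three_halves_le: "(\<Sum>p=2..N. 1 / (real p * sqrt (real p))) \<le> 2"
proof -
  have "(\<Sum>p=2..N. 1 / (real p * sqrt (real p))) \<le> 2 - 2 / sqrt (real N)" if "N \<ge> 1"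
    using that
  proof (induction N rule: dec_induct)
    case (step N)
    define a b where "a = sqrt (real N)" and "b = sqrt (real (Suc N))"
    have a_b: "0 < a" "a \<le> b" "b\<^sup>2 - a\<^sup>2 = 1"
      using step by (auto simp: a_def b_def)
    have "b\<^sup>2 - a\<^sup>2 = (b - a) * (b + a)" by (simp add: power2_eq_square algebra_simps)
    also have "\<dots> \<le> (b - a) * (2 * b)" using a_b by (intro mult_left_mono) auto
    finally have "1 / (b\<^sup>2 * b) \<le> (b - a) * (2 * b) / (b\<^sup>2 * b)"
      using a_b by (intro divide_right_mono) auto
    also have "\<dots> = 2 * (b - a) / (b * b)" using a_b by (simp add: power2_eq_square)
    also have "\<dots> \<le> 2 * (b - a) / (a * b)"
      using a_b by (intro divide_left_mono mult_right_mono) auto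
    also have "\<dots> = 2 / a - 2 / b" using a_b by (simp add: field_simps)
    finally have "1 / (real (Suc N) * b) \<le> 2 / a - 2 / b" by (simp add: b_def)
    then show ?case using step by (simp add: a_def b_def)
  qed simp
  then show ?thesis by (cases "N = 0") (auto intro: order_trans)
qed

lemma mertens_sum_nonprime_le_8: "mertens_sum (\<lambda>n. of_bool (\<not> prime n)) N \<le> (8::real)"
proof -
  have "mertens_sum (\<lambda>n. of_bool (\<not> prime n)) N \<le>
      (\<Sum>p=2..N. ln (real p) * (\<Sum>k=2..N. (1 / real p) ^ k))"
    by (rule mertens_sum_nonprime_le)
  also have "\<dots> \<le> (\<Sum>p=2..N. 4 * (1 / (real p * sqrt (real p))))"
  proof (rule sum_mono)
    fix p assume p_range: "p \<in> {2..N}"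
    have "ln (real p) = 2 * ln (sqrt (real p))" using p_range by (simp add: ln_sqrt)
    also have "\<dots> \<le> 2 * sqrt (real p)" using ln_le_minus_one[of "sqrt (real p)"] p_range by simp
    finally have "ln (real p) * (\<Sum>k=2..N. (1 / real p) ^ k) \<le>
        2 * sqrt (real p) * (2 * (1 / real p)\<^sup>2)"
      using p_range by (intro mult_mono sum_power_from_2_le sum_nonneg) (auto simp: field_simps)
    also have "\<dots> = 4 * (1 / (real p * sqrt (real p)))"
      using p_range by (simp add: power2_eq_square field_simps)
    finally show "ln (real p) * (\<Sum>k=2..N. (1 / real p) ^ k) \<le> 4 * (1 / (real p * sqrt (real p)))" .
  qed
  also have "\<dots> \<le> 8"
    using sum_inverse_three_halves_le[of N] by (simp only: flip: sum_distrib_left)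
  finally show ?thesis .
qed

section \<open>Bounded completely multiplicative functions\<close>

text \<open>\<open>L(1, \<chi>)\<close>; the term at \<open>n = 0\<close> vanishes, because division by \<open>0\<close> gives \<open>0\<close>.\<close>

definition L1 :: "(nat \<Rightarrow> 'a::{real_normed_field,banach}) \<Rightarrow> 'a" where
  "L1 \<chi> = (\<Sum>n. \<chi> n / of_nat n)"

locale bounded_character =
  fixes \<chi> :: "nat \<Rightarrow> 'a::{real_normed_field,banach}" and B :: real
  assumes chi_1: "\<chi> 1 = 1"
    and chi_mult: "\<chi> (m * n) = \<chi> m * \<chi> n"
    and norm_chi_le: "norm (\<chi> n) \<le> 1"
    and norm_sum_chi_le: "norm (\<Sum>n=M..<N. \<chi> n) \<le> B"
begin

lemma B_nonneg: "B \<ge> 0"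
  using order_trans[OF norm_ge_zero norm_sum_chi_le] .

lemma summable_L1: "summable (\<lambda>n. \<chi> n / of_nat n)"
  and L1_remainder: "norm ((\<Sum>n=1..N. \<chi> n / of_nat n) - L1 \<chi>) \<le> B / real (Suc N)"
proof -
  have scaleR: "(1 / real n) *\<^sub>R \<chi> n = \<chi> n / of_nat n" for n
    by (simp add: scaleR_conv_of_real)
  have antimono: "1 / real (Suc n) \<le> 1 / real n" if "n \<ge> 1" for n
    using that by (intro divide_left_mono) auto
  show "summable (\<lambda>n. \<chi> n / of_nat n)"
    using summable_dirichlet_test[of \<chi> B 1 "\<lambda>n. 1 / real n",
      OF norm_sum_chi_le antimono _ lim_1_over_n]
    by (simp only: scaleR) simp
  have "norm ((\<Sum>n<Suc N. \<chi> n / of_nat n) - L1 \<chi>) \<le> B * (1 / real (Suc N))"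
    using norm_dirichlet_tail_le[of \<chi> B 1 "\<lambda>n. 1 / real n" "Suc N",
      OF norm_sum_chi_le antimono _ lim_1_over_n]
    by (simp only: scaleR L1_def) simp
  moreover have "(\<Sum>n<Suc N. \<chi> n / of_nat n) = (\<Sum>n=1..N. \<chi> n / of_nat n)"
    by (intro sum.mono_neutral_right) (auto simp: not_le)
  ultimately show "norm ((\<Sum>n=1..N. \<chi> n / of_nat n) - L1 \<chi>) \<le> B / real (Suc N)" by simp
qed

lemma sum_chi_ln_bounded:
  obtains C where "\<And>N. norm (\<Sum>n=1..N. \<chi> n * of_real (ln (real n)) / of_nat n) \<le> C"
proof -
  define w where "w n = ln (real n) / real n" for n
  have antimono: "w (Suc n) \<le> w n" if "n \<ge> 3" for n
    unfolding w_def
  proof (rule ln_x_over_x_mono)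
    show "exp 1 \<le> real n" using exp_le that by linarith
  qed auto
  have lim: "w \<longlonglongrightarrow> 0"
    unfolding w_def by (rule filterlim_compose[OF ln_x_over_x_tendsto_0 filterlim_real_sequentially])
  have "summable (\<lambda>n. w n *\<^sub>R \<chi> n)"
    by (rule summable_dirichlet_test[OF norm_sum_chi_le antimono _ lim]) (auto simp: w_def)
  then have "Bseq (\<lambda>N. \<Sum>n<N. w n *\<^sub>R \<chi> n)"
    by (metis convergent_def convergent_imp_Bseq summable_LIMSEQ)
  then obtain C where bound: "\<And>N. norm (\<Sum>n<N. w n *\<^sub>R \<chi> n) \<le> C" by (metis BseqE)
  have "(\<Sum>n=1..N. \<chi> n * of_real (ln (real n)) / of_nat n) = (\<Sum>n<Suc N. w n *\<^sub>R \<chi> n)" for N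
    by (intro sum.mono_neutral_cong_left) (auto simp: w_def scaleR_conv_of_real not_le)
  with bound show ?thesis using that by metis
qed

lemma sum_chi_sum_divisors:
  "(\<Sum>n=1..N. \<chi> n / of_nat n * (\<Sum>d | d dvd n. f d)) =
   (\<Sum>d=1..N. \<chi> d * f d / of_nat d * (\<Sum>e=1..N div d. \<chi> e / of_nat e))"
proof -
  have "(\<Sum>n=1..N. \<chi> n / of_nat n * (\<Sum>d | d dvd n. f d)) =
        (\<Sum>n=1..N. \<Sum>d | d dvd n. \<chi> d * f d / of_nat d * (\<chi> (n div d) / of_nat (n div d)))"
    unfolding sum_distrib_left
  proof (intro sum.cong refl)
    fix n d assume "n \<in> {1..N}" "d \<in> {d. d dvd n}"
    then obtain e where "n = d * e" "d > 0" by (auto elim!: dvdE intro: Nat.gr0I)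
    then show "\<chi> n / of_nat n * f d = \<chi> d * f d / of_nat d * (\<chi> (n div d) / of_nat (n div d))"
      by (simp add: chi_mult)
  qed
  also have "\<dots> = (\<Sum>d=1..N. \<Sum>e=1..N div d. \<chi> d * f d / of_nat d * (\<chi> e / of_nat e))"
    by (rule sum_upto_sum_divisors)
  finally show ?thesis by (simp only: sum_distrib_left)
qed

lemma norm_sum_chi_sum_divisors_minus_L1_le:
  "norm ((\<Sum>n=1..N. \<chi> n / of_nat n * (\<Sum>d | d dvd n. f d)) - L1 \<chi> * (\<Sum>d=1..N. \<chi> d * f d / of_nat d))
   \<le> B / real N * (\<Sum>d=1..N. norm (f d))"
proof -
  let ?S = "\<lambda>m. \<Sum>e=1..m. \<chi> e / of_nat e"
  have "(\<Sum>n=1..N. \<chi> n / of_nat n * (\<Sum>d | d dvd n. f d)) - L1 \<chi> * (\<Sum>d=1..N. \<chi> d * f d / of_nat d) =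
        (\<Sum>d=1..N. \<chi> d * f d / of_nat d * (?S (N div d) - L1 \<chi>))"
    unfolding sum_chi_sum_divisors
    by (simp only: right_diff_distrib sum_subtractf sum_distrib_right mult.commute[of "L1 \<chi>"])
  also have "norm \<dots> \<le> (\<Sum>d=1..N. B / real N * norm (f d))"
  proof (rule sum_norm_le)
    fix d assume d_range: "d \<in> {1..N}"
    have "norm (?S (N div d) - L1 \<chi>) \<le> B / real (Suc (N div d))" by (rule L1_remainder)
    also have "\<dots> \<le> B / (real N / real d)"
      using B_nonneg d_range real_divide_le_Suc_div[of d N]
      by (intro divide_left_mono mult_pos_pos) (auto simp del: of_nat_Suc)
    finally have "norm (\<chi> d) * (norm (f d) * norm (?S (N div d) - L1 \<chi>)) / real d \<le>
        1 * (norm (f d) * (B / (real N / real d))) / real d"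
      using B_nonneg by (intro divide_right_mono mult_mono norm_chi_le mult_nonneg_nonneg) auto
    then show "norm (\<chi> d * f d / of_nat d * (?S (N div d) - L1 \<chi>)) \<le> B / real N * norm (f d)"
      using d_range by (simp add: norm_mult norm_divide mult_ac)
  qed
  finally show ?thesis by (simp only: sum_distrib_left)
qed

lemma mertens_sum_bounded:
  assumes "L1 \<chi> \<noteq> 0"
  obtains C where "\<And>N. norm (mertens_sum \<chi> N) \<le> C"
proof -
  obtain C where bound: "\<And>N. norm (\<Sum>n=1..N. \<chi> n * of_real (ln (real n)) / of_nat n) \<le> C"
    using sum_chi_ln_bounded by blast
  have "norm (mertens_sum \<chi> N) \<le> (C + 4 * B) / norm (L1 \<chi>)" for N
  proof -
    let ?T = "\<Sum>n=1..N. \<chi> n * of_real (ln (real n)) / of_nat n"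
    have "?T = (\<Sum>n=1..N. \<chi> n / of_nat n * (\<Sum>d | d dvd n. mangoldt d))"
      by (intro sum.cong) (simp_all add: mangoldt_sum)
    then have "norm (?T - L1 \<chi> * mertens_sum \<chi> N) \<le> B / real N * (\<Sum>d=1..N. mangoldt d)"
      using norm_sum_chi_sum_divisors_minus_L1_le[of mangoldt N] by (simp add: mertens_sum_def)
    also have "\<dots> \<le> B / real N * (4 * real N)"
      using B_nonneg by (intro mult_left_mono sum_mangoldt_le) auto
    also have "\<dots> \<le> 4 * B" using B_nonneg by (cases "N = 0") auto
    finally have "norm (L1 \<chi> * mertens_sum \<chi> N) \<le> C + 4 * B"
      using bound[of N] norm_triangle_ineq4[of ?T "?T - L1 \<chi> * mertens_sum \<chi> N"] by simp
    then show ?thesis using assms by (simp add: norm_mult pos_le_divide_eq mult.commute)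
  qed
  then show ?thesis using that by blast
qed

lemma norm_mertens_sum_plus_ln_le:
  assumes "L1 \<chi> = 0" and N_pos: "N > 0"
  shows "norm (mertens_sum \<chi> N + of_real (ln (real N))) \<le> B"
proof -
  define f where "f d = moebius d * (of_real (ln (real N / real d)) :: 'a)" for d
  have "(\<Sum>n=1..N. \<chi> n / of_nat n * (\<Sum>d | d dvd n. f d)) =
        (\<Sum>n=1..N. \<chi> n * mangoldt n / of_nat n + (if n = 1 then of_real (ln (real N)) else 0))"
  proof (intro sum.cong refl)
    fix n assume n_range: "n \<in> {1..N}"
    have "(\<Sum>d | d dvd n. f d) =
          (\<Sum>d | d dvd n. moebius d * of_real (ln (real (n div d))) +
             moebius d * of_real (ln (real N / real n)))"
      using n_range
      by (intro sum.cong refl) (auto simp: f_def ln_div ln_mult algebra_simps elim!: dvdE)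
    also have "\<dots> = mangoldt n + of_bool (n = 1) * of_real (ln (real N / real n))"
      using n_range moebius_inversion[of "\<lambda>n. of_real (ln (real n))" "mangoldt :: nat \<Rightarrow> 'a" n]
      by (simp add: sum.distrib mangoldt_sum sum_moebius_divisors flip: sum_distrib_right)
    finally show "\<chi> n / of_nat n * (\<Sum>d | d dvd n. f d) =
        \<chi> n * mangoldt n / of_nat n + (if n = 1 then of_real (ln (real N)) else 0)"
      using chi_1 by auto
  qed
  also have "\<dots> = mertens_sum \<chi> N + of_real (ln (real N))"
    using N_pos by (simp add: sum.distrib mertens_sum_def)
  finally have "norm (mertens_sum \<chi> N + of_real (ln (real N))) \<le> B / real N * (\<Sum>d=1..N. norm (f d))"
    using norm_sum_chi_sum_divisors_minus_L1_le[of f N] assms by simp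
  also have "\<dots> \<le> B / real N * (\<Sum>d=1..N. ln (real N / real d))"
    using B_nonneg norm_moebius_le[where ?'a = 'a]
    by (intro mult_left_mono sum_mono) (auto simp: f_def norm_mult mult_left_le_one_le)
  also have "(\<Sum>d=1..N. ln (real N / real d)) = real N * ln (real N) - (\<Sum>d=1..N. ln (real d))"
    using N_pos by (simp add: ln_div sum_subtractf)
  also have "(\<Sum>d=1..N. ln (real d)) = ln (fact N)"
    by (rule ln_fact_conv_sum [symmetric])
  also have "B / real N * (real N * ln (real N) - ln (fact N)) \<le> B / real N * real N"
    using B_nonneg ln_fact_ge[of N] by (intro mult_left_mono) auto
  also have "\<dots> = B" using N_pos by simp
  finally show ?thesis .
qed

end

section \<open>Real characters\<close>

lemma mult_power_le_sum_power_squares: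
  fixes t :: real
  shows "real n * t ^ (n - 1) \<le> (\<Sum>i<n. (t\<^sup>2) ^ i)"
proof -
  have "2 * (real n * t ^ (n - 1)) = (\<Sum>i<n. 2 * (t ^ i * t ^ (n - 1 - i)))"
    by (simp flip: power_add)
  also have "\<dots> \<le> (\<Sum>i<n. (t\<^sup>2) ^ i + (t\<^sup>2) ^ (n - 1 - i))"
  proof (rule sum_mono)
    fix i
    show "2 * (t ^ i * t ^ (n - 1 - i)) \<le> (t\<^sup>2) ^ i + (t\<^sup>2) ^ (n - 1 - i)"
      using sum_squares_bound[of "t ^ i" "t ^ (n - 1 - i)"] by (simp add: mult_ac flip: power_mult)
  qed
  also have "\<dots> = 2 * (\<Sum>i<n. (t\<^sup>2) ^ i)"
    by (simp add: sum.distrib sum.nat_diff_reindex[of "\<lambda>i. (t\<^sup>2) ^ i" n])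
  finally show ?thesis by simp
qed

text \<open>Up to the factor \<open>1 - x\<close>, this is \<open>1 / (n (1 - x)) - x ^ n / (1 - x ^ n)\<close>.\<close>

definition lambert_gap :: "real \<Rightarrow> nat \<Rightarrow> real" where
  "lambert_gap x n = 1 / real n - x ^ n / (\<Sum>i<n. x ^ i)"

lemma lambert_gap_1: "lambert_gap x 1 = 1 - x"
  by (simp add: lambert_gap_def)

lemma lambert_gap_nonneg:
  assumes "0 < x" "x < 1" "n > 0"
  shows "lambert_gap x n \<ge> 0"
proof -
  have "real n * x ^ n = (\<Sum>i<n. x ^ n)" by simp
  also have "\<dots> \<le> (\<Sum>i<n. x ^ i)" using assms by (intro sum_mono power_decreasing) auto
  finally have "real n * x ^ n \<le> (\<Sum>i<n. x ^ i)" .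
  moreover have "(\<Sum>i<n. x ^ i) > 0" using assms by (intro sum_pos) auto
  ultimately show ?thesis using assms by (simp add: lambert_gap_def field_simps)
qed

lemma lambert_gap_antimono:
  assumes x_range: "0 < x" "x < 1" and n_pos: "n > 0"
  shows "lambert_gap x (Suc n) \<le> lambert_gap x n"
proof -
  define g where "g n = (\<Sum>i<n. x ^ i)" for n
  have g_pos: "g n > 0" "g (Suc n) > 0"
    using x_range n_pos by (auto simp: g_def intro!: sum_pos add_pos_pos)
  have g_Suc: "g (Suc n) = 1 + x * g n"
    unfolding g_def by (subst sum.lessThan_Suc_shift) (simp add: sum_distrib_left)
  have "real n * real (Suc n) * x ^ n \<le> (real n * sqrt x ^ (n - 1)) * (real (Suc n) * sqrt x ^ n)"
  proof -
    have "x ^ n = sqrt x ^ (2 * n)" using x_range by (simp add: power_mult)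
    also have "\<dots> \<le> sqrt x ^ (n - 1 + n)" using x_range by (intro power_decreasing) auto
    finally show ?thesis by (simp add: power_add mult_ac mult_left_mono)
  qed
  also have "\<dots> \<le> g n * g (Suc n)"
    using mult_power_le_sum_power_squares[of n "sqrt x"]
      mult_power_le_sum_power_squares[of "Suc n" "sqrt x"]
      x_range n_pos g_pos by (intro mult_mono) (auto simp: g_def)
  finally have product_ge: "real n * real (Suc n) * x ^ n \<le> g n * g (Suc n)" .
  have "x ^ n / g n - x ^ Suc n / g (Suc n) = x ^ n / (g n * g (Suc n))"
    using g_pos g_Suc by (simp add: field_simps)
  also have "\<dots> \<le> 1 / (real n * real (Suc n))"
    using product_ge g_pos n_pos by (simp add: divide_simps mult_ac del: of_nat_Suc)
  also have "\<dots> = 1 / real n - 1 / real (Suc n)" using n_pos by (simp add: field_simps)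
  finally show ?thesis by (simp add: lambert_gap_def g_def)
qed

lemma sum_power_multiples:
  fixes x :: real
  assumes "0 \<le> x" "x < 1" "d > 0"
  shows "(\<Sum>e=1..k. x ^ (d * e)) = (x ^ d - x ^ (d * Suc k)) / (1 - x ^ d)"
proof -
  have "x ^ d < 1" using assms by (simp add: power_less_one_iff)
  then show ?thesis
    using sum_gp_multiplied[of 1 k "x ^ d"]
    by (cases "k = 0") (simp_all add: field_simps flip: power_mult power_add)
qed

locale real_character = bounded_character \<chi> B for \<chi> :: "nat \<Rightarrow> real" and B +
  assumes chi_values: "\<chi> n \<in> {-1, 0, 1}"
begin

lemma chi_power: "\<chi> (n ^ k) = \<chi> n ^ k"
  using chi_1 by (induction k) (auto simp: chi_mult)

lemma sum_chi_divisors_prime_power_mult: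
  assumes "prime p" "\<not> p dvd m"
  shows "(\<Sum>d | d dvd p ^ k * m. \<chi> d) = (\<Sum>i\<le>k. \<chi> p ^ i) * (\<Sum>d | d dvd m. \<chi> d)"
  unfolding sum_divisors_prime_power_mult[OF assms] by (simp add: chi_mult chi_power sum_product)

lemma sum_chi_powers:
  shows sum_chi_powers_nonneg: "(\<Sum>i\<le>k. \<chi> p ^ i) \<ge> 0"
    and sum_chi_even_powers_ge_1: "(\<Sum>i\<le>2 * k. \<chi> p ^ i) \<ge> 1"
proof -
  have "(\<Sum>i\<le>k. (-1) ^ i) = (of_bool (even k) :: real)" for k by (induction k) auto
  then show "(\<Sum>i\<le>k. \<chi> p ^ i) \<ge> 0" "(\<Sum>i\<le>2 * k. \<chi> p ^ i) \<ge> 1"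
    using chi_values[of p] by (auto simp: power_0_left)
qed

lemma sum_chi_divisors:
  assumes "n > 0"
  shows sum_chi_divisors_nonneg: "(\<Sum>d | d dvd n. \<chi> d) \<ge> 0"
    and sum_chi_divisors_square_ge_1: "(\<Sum>d | d dvd n\<^sup>2. \<chi> d) \<ge> 1"
proof -
  have "(\<Sum>d | d dvd n. \<chi> d) \<ge> 0 \<and> (\<Sum>d | d dvd n\<^sup>2. \<chi> d) \<ge> 1"
    using assms
  proof (induction n rule: less_induct)
    case (less n)
    show ?case
    proof (cases "n = 1")
      case True
      then show ?thesis using chi_1 by simp
    next
      case False
      with less have "n > 1" by simp
      then obtain p k m where decomposition: "prime p" "\<not> p dvd m" "n = p ^ k * m" "m < n" "m > 0"
        by (rule prime_power_decomposition_nat)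
      have "n\<^sup>2 = p ^ (2 * k) * m\<^sup>2"
        by (simp add: decomposition power_mult_distrib power_mult mult.commute)
      moreover have "\<not> p dvd m\<^sup>2" using decomposition prime_dvd_power by blast
      ultimately have "(\<Sum>d | d dvd n\<^sup>2. \<chi> d) = (\<Sum>i\<le>2 * k. \<chi> p ^ i) * (\<Sum>d | d dvd m\<^sup>2. \<chi> d)"
        using decomposition(1) sum_chi_divisors_prime_power_mult by presburger
      moreover have "(\<Sum>d | d dvd n. \<chi> d) = (\<Sum>i\<le>k. \<chi> p ^ i) * (\<Sum>d | d dvd m. \<chi> d)"
        unfolding decomposition(3) using decomposition by (intro sum_chi_divisors_prime_power_mult)
      moreover have "(\<Sum>i\<le>2 * k. \<chi> p ^ i) * (\<Sum>d | d dvd m\<^sup>2. \<chi> d) \<ge> 1 * 1"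
        using sum_chi_even_powers_ge_1[of p k] less.IH[of m] decomposition by (intro mult_mono) auto
      ultimately show ?thesis using sum_chi_powers_nonneg[of p k] less.IH[of m] decomposition by auto
    qed
  qed
  then show "(\<Sum>d | d dvd n. \<chi> d) \<ge> 0" "(\<Sum>d | d dvd n\<^sup>2. \<chi> d) \<ge> 1" by auto
qed

lemma sum_power_squares_le_lambert_sum:
  assumes x_range: "0 < x" "x < 1" and M_le: "M\<^sup>2 \<le> N"
  shows "(\<Sum>m=1..M. x ^ (m\<^sup>2)) \<le> (\<Sum>d=1..N. \<chi> d * (x ^ d / (1 - x ^ d))) + real N * x ^ N / (1 - x)"
proof -
  define r where "r n = (\<Sum>d | d dvd n. \<chi> d)" for n
  have "(\<Sum>m=1..M. x ^ (m\<^sup>2)) \<le> (\<Sum>m=1..M. r (m\<^sup>2) * x ^ (m\<^sup>2))"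
    using x_range sum_chi_divisors_square_ge_1 by (intro sum_mono) (auto simp: r_def)
  also have "\<dots> = (\<Sum>n\<in>(\<lambda>m. m\<^sup>2) ` {1..M}. r n * x ^ n)"
    by (subst sum.reindex) (auto simp: inj_on_def)
  also have "\<dots> \<le> (\<Sum>n=1..N. r n * x ^ n)"
  proof (rule sum_mono2)
    have "m\<^sup>2 \<le> N" if "m \<le> M" for m using that M_le power_mono[of m M 2] by linarith
    then show "(\<lambda>m. m\<^sup>2) ` {1..M} \<subseteq> {1..N}" by auto
  qed (use x_range sum_chi_divisors_nonneg in \<open>auto simp: r_def\<close>)
  also have "\<dots> = (\<Sum>n=1..N. \<Sum>d | d dvd n. \<chi> d * x ^ (d * (n div d)))"
    by (simp add: r_def sum_distrib_right)
  also have "\<dots> = (\<Sum>d=1..N. \<Sum>e=1..N div d. \<chi> d * x ^ (d * e))"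
    by (rule sum_upto_sum_divisors)
  also have "\<dots> \<le> (\<Sum>d=1..N. \<chi> d * (x ^ d / (1 - x ^ d)) + x ^ N / (1 - x))"
  proof (rule sum_mono)
    fix d assume d_range: "d \<in> {1..N}"
    define k where "k = Suc (N div d)"
    have power_le: "x ^ d \<le> x" using x_range d_range power_decreasing[of 1 d x] by simp
    have "N \<le> d * k" using dividend_less_times_div[of d N] d_range by (simp add: k_def)
    then have "x ^ (d * k) / (1 - x ^ d) \<le> x ^ N / (1 - x)"
      using x_range power_le by (intro frac_le power_decreasing) auto
    moreover have "- \<chi> d * (x ^ (d * k) / (1 - x ^ d)) \<le> 1 * (x ^ (d * k) / (1 - x ^ d))"
      using x_range power_le norm_chi_le[of d] by (intro mult_right_mono) auto
    moreover have "(\<Sum>e=1..N div d. \<chi> d * x ^ (d * e)) = \<chi> d * ((x ^ d - x ^ (d * k)) / (1 - x ^ d))"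
      unfolding k_def sum_distrib_left[symmetric]
      using x_range d_range by (subst sum_power_multiples) auto
    ultimately show "(\<Sum>e=1..N div d. \<chi> d * x ^ (d * e)) \<le>
        \<chi> d * (x ^ d / (1 - x ^ d)) + x ^ N / (1 - x)"
      by (simp add: diff_divide_distrib right_diff_distrib)
  qed
  finally show ?thesis by (simp add: sum.distrib)
qed

lemma lambert_sum_le:
  assumes x_range: "0 < x" "x < 1" and L1_eq_0: "L1 \<chi> = 0"
  shows "(\<Sum>d=1..N. \<chi> d * (x ^ d / (1 - x ^ d))) \<le> B + B / real (Suc N) / (1 - x)"
proof -
  have "x ^ d / (1 - x ^ d) = (1 / real d - lambert_gap x d) / (1 - x)" for d
    using x_range by (simp add: lambert_gap_def one_diff_power_eq mult.commute)
  then have "(\<Sum>d=1..N. \<chi> d * (x ^ d / (1 - x ^ d))) =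
      ((\<Sum>d=1..N. \<chi> d / real d) - (\<Sum>d=1..N. lambert_gap x d * \<chi> d)) / (1 - x)"
    by (simp add: right_diff_distrib sum_subtractf mult.commute flip: sum_divide_distrib)
  also have "\<dots> \<le> (B / real (Suc N) + B * (1 - x)) / (1 - x)"
  proof (intro divide_right_mono)
    have "\<bar>\<Sum>d=1..N. \<chi> d / real d\<bar> \<le> B / real (Suc N)"
      using L1_remainder[of N] L1_eq_0 by simp
    moreover have "norm (\<Sum>d=1..<Suc N. lambert_gap x d *\<^sub>R \<chi> d) \<le> B * lambert_gap x 1"
      using x_range
      by (intro norm_sum_antimono_le norm_sum_chi_le lambert_gap_antimono lambert_gap_nonneg) auto
    ultimately show "(\<Sum>d=1..N. \<chi> d / real d) - (\<Sum>d=1..N. lambert_gap x d * \<chi> d)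
        \<le> B / real (Suc N) + B * (1 - x)"
      unfolding lambert_gap_1
      by (simp only: real_norm_def real_scaleR_def atLeastLessThanSuc_atLeastAtMost)
  qed (use x_range in simp)
  also have "\<dots> = B + B / real (Suc N) / (1 - x)" using x_range by (simp add: add_divide_distrib)
  finally show ?thesis .
qed

lemma sum_power_squares_le:
  assumes x_range: "0 < x" "x < 1" and L1_eq_0: "L1 \<chi> = 0"
  shows "(\<Sum>m=1..M. x ^ (m\<^sup>2)) \<le> B"
proof (rule tendsto_lowerbound)
  have "(\<lambda>N. real N * x ^ N) \<longlonglongrightarrow> 0" using x_range by (intro powser_times_n_limit_0) auto
  then have "(\<lambda>N. B + B / real (Suc N) / (1 - x) + real N * x ^ N / (1 - x)) \<longlonglongrightarrow>
      B + 0 / (1 - x) + 0 / (1 - x)"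
    using x_range by (intro tendsto_intros LIMSEQ_Suc[OF lim_const_over_n]) auto
  then show "(\<lambda>N. B + B / real (Suc N) / (1 - x) + real N * x ^ N / (1 - x)) \<longlonglongrightarrow> B" by simp
  show "eventually (\<lambda>N. (\<Sum>m=1..M. x ^ (m\<^sup>2)) \<le>
      B + B / real (Suc N) / (1 - x) + real N * x ^ N / (1 - x)) sequentially"
    using eventually_ge_at_top[of "M\<^sup>2"]
  proof eventually_elim
    case (elim N)
    then show ?case
      using sum_power_squares_le_lambert_sum[OF x_range elim] lambert_sum_le[OF x_range L1_eq_0, of N]
      by linarith
  qed
qed simp

theorem L1_nonzero: "L1 \<chi> \<noteq> 0"
proof
  assume L1_eq_0: "L1 \<chi> = 0"
  obtain M :: nat where M_gt: "B < real M" using reals_Archimedean2 by blast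
  have "((\<lambda>x::real. \<Sum>m=1..M. x ^ (m\<^sup>2)) \<longlongrightarrow> (\<Sum>m=1..M. 1 ^ (m\<^sup>2))) (at_left 1)"
    by (intro tendsto_intros)
  moreover have "eventually (\<lambda>x. (\<Sum>m=1..M. x ^ (m\<^sup>2)) \<le> B) (at_left (1::real))"
    using eventually_at_left_real[of 0 1] sum_power_squares_le[OF _ _ L1_eq_0]
    by (auto elim: eventually_mono)
  ultimately have "(\<Sum>m=1..M. 1 ^ (m\<^sup>2)) \<le> B" by (intro tendsto_upperbound) auto
  with M_gt show False by simp
qed

end

section \<open>Dirichlet characters modulo a prime\<close>

lemma norm_sum_periodic_le:
  fixes c :: "nat \<Rightarrow> 'a::real_normed_vector"
  assumes "q > 0" and periodic: "\<And>n. c (n + q) = c n" and sum_period: "(\<Sum>n<q. c n) = 0"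
    and norm_le: "\<And>n. norm (c n) \<le> 1"
  shows "norm (\<Sum>n=M..<N. c n) \<le> real q"
proof (induction N rule: less_induct)
  case (less N)
  show ?case
  proof (cases "N \<le> M + q")
    case True
    have "norm (\<Sum>n=M..<N. c n) \<le> (\<Sum>n=M..<N. 1)" by (intro sum_norm_le norm_le)
    then show ?thesis using True by simp
  next
    case False
    have shift: "(\<Sum>n<m + q. c n) = (\<Sum>n<m. c n)" for m
      by (induction m) (simp_all add: sum_period periodic)
    have interval: "(\<Sum>n=M..<m. c n) = (\<Sum>n<m. c n) - (\<Sum>n<M. c n)" if "M \<le> m" for m
      using sum.atLeastLessThan_concat[of 0 M m c] that
      by (simp add: atLeast0LessThan eq_diff_eq add.commute)
    have "(\<Sum>n=M..<N. c n) = (\<Sum>n=M..<N - q. c n)"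
      using False shift[of "N - q"] by (simp add: interval)
    then show ?thesis using less.IH[of "N - q"] False \<open>q > 0\<close> by simp
  qed
qed

lemma sum_powers_root_of_unity:
  fixes u :: "'a::field"
  assumes "u ^ m = 1"
  shows "(\<Sum>k<m. u ^ k) = (if u = 1 then of_nat m else 0)"
  using assms by (simp add: geometric_sum)

lemma ex_ln_nat_gt: "\<exists>N>0. ln (real N) > X"
proof -
  have "eventually (\<lambda>N. X < ln (real N)) sequentially"
    using filterlim_compose[OF ln_at_top filterlim_real_sequentially]
    by (simp add: filterlim_at_top_dense)
  then have "eventually (\<lambda>N. N > 0 \<and> X < ln (real N)) sequentially"
    using eventually_gt_at_top[of 0] by eventually_elim auto
  then show ?thesis by (auto dest: eventually_happens)
qed

locale prime_modulus =
  fixes q g :: nat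
  assumes prime_q: "prime q" and primroot_g: "residue_primroot q g"
begin

\<comment> \<open>Otherwise \<open>q - 1\<close> turns into \<open>q - Suc 0\<close> and no longer matches the lemmas below.\<close>
declare One_nat_def [simp del]

lemma q_gt_1: "q > 1" using prime_q by (rule prime_gt_1_nat)

lemma bij_betw_generator: "bij_betw (\<lambda>i. g ^ i mod q) {..<q - 1} {0<..<q}"
  using residue_primroot_is_generator[OF q_gt_1 primroot_g] prime_q
  by (simp add: totient_prime totatives_prime)

definition ind :: "nat \<Rightarrow> nat" where
  "ind n = inv_into {..<q - 1} (\<lambda>i. g ^ i mod q) (n mod q)"

lemma bij_betw_ind: "bij_betw ind {0<..<q} {..<q - 1}"
  using bij_betw_inv_into[OF bij_betw_generator]
  by (rule bij_betw_cong[THEN iffD1, rotated]) (simp add: ind_def)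

lemma mod_q_in_units: "\<not> q dvd n \<Longrightarrow> n mod q \<in> {0<..<q}"
  using q_gt_1 by (auto simp: mod_greater_zero_iff_not_dvd)

lemma ind_less: "\<not> q dvd n \<Longrightarrow> ind n < q - 1"
  using bij_betw_apply[OF bij_betw_ind mod_q_in_units] by (simp add: ind_def)

lemma power_ind_cong: "\<not> q dvd n \<Longrightarrow> [g ^ ind n = n] (mod q)"
  using bij_betw_inv_into_right[OF bij_betw_generator mod_q_in_units] by (simp add: ind_def cong_def)

lemma ind_eq_iff:
  assumes "\<not> q dvd m" "\<not> q dvd n"
  shows "ind m = ind n \<longleftrightarrow> [m = n] (mod q)"
proof
  assume "ind m = ind n"
  then show "[m = n] (mod q)" using power_ind_cong[OF assms(1)] power_ind_cong[OF assms(2)]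
    by (metis cong_sym cong_trans)
qed (simp add: ind_def cong_def)

lemma ind_mult_cong:
  assumes "\<not> q dvd m" "\<not> q dvd n"
  shows "[ind (m * n) = ind m + ind n] (mod (q - 1))"
proof -
  have "\<not> q dvd m * n" using assms prime_q by (simp add: prime_dvd_mult_iff)
  then have "[g ^ ind (m * n) = m * n] (mod q)" by (rule power_ind_cong)
  also have "[m * n = g ^ ind m * g ^ ind n] (mod q)"
    using assms by (intro cong_mult cong_sym[OF power_ind_cong])
  finally have "[g ^ ind (m * n) = g ^ (ind m + ind n)] (mod q)" by (simp add: power_add)
  then show ?thesis
    using primroot_g prime_q order_divides_expdiff[of q g]
    by (simp add: residue_primroot_def totient_prime)
qed

definition \<zeta> :: complex where
  "\<zeta> = cis (2 * pi / real (q - 1))"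

lemma zeta_power_order: "\<zeta> ^ (q - 1) = 1"
  using q_gt_1 by (simp add: \<zeta>_def DeMoivre)

lemma zeta_power_mod: "\<zeta> ^ (i mod (q - 1)) = \<zeta> ^ i"
proof -
  have "\<zeta> ^ i = \<zeta> ^ ((q - 1) * (i div (q - 1)) + i mod (q - 1))" by simp
  also have "\<dots> = \<zeta> ^ (i mod (q - 1))"
    by (simp only: power_add power_mult zeta_power_order power_one mult_1)
  finally show ?thesis ..
qed

lemma zeta_power_eq_iff: "\<zeta> ^ i = \<zeta> ^ j \<longleftrightarrow> [i = j] (mod (q - 1))"
proof
  assume "\<zeta> ^ i = \<zeta> ^ j"
  then have "\<zeta> ^ (i mod (q - 1)) = \<zeta> ^ (j mod (q - 1))" by (simp only: zeta_power_mod)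
  moreover have "inj_on (\<lambda>k. \<zeta> ^ k) {..<q - 1}"
    using bij_betw_roots_unity[of "q - 1"] q_gt_1
    by (simp add: bij_betw_def \<zeta>_def DeMoivre mult_ac)
  ultimately show "[i = j] (mod (q - 1))"
    using q_gt_1 by (auto simp: cong_def dest: inj_onD)
next
  assume "[i = j] (mod (q - 1))"
  then show "\<zeta> ^ i = \<zeta> ^ j" by (metis zeta_power_mod cong_def)
qed

text \<open>On the integers prime to \<open>q\<close>, \<open>\<omega>\<close> is a generator of the group of characters.\<close>

definition \<omega> :: "nat \<Rightarrow> complex" where
  "\<omega> n = \<zeta> ^ ind n"

lemma norm_omega [simp]: "norm (\<omega> n) = 1"
  by (simp add: \<omega>_def \<zeta>_def norm_power)

lemma omega_nonzero [simp]: "\<omega> n \<noteq> 0"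
  using norm_omega[of n] by (metis norm_zero zero_neq_one)

lemma omega_power_order: "\<omega> n ^ (q - 1) = 1"
  by (metis \<omega>_def power_commutes power_mult mult.commute zeta_power_order power_one)

lemma cnj_omega_mult_omega: "cnj (\<omega> n) * \<omega> n = 1"
  using complex_norm_square[of "\<omega> n"] by (simp add: mult.commute)

lemma omega_mult: "\<not> q dvd m \<Longrightarrow> \<not> q dvd n \<Longrightarrow> \<omega> (m * n) = \<omega> m * \<omega> n"
  unfolding \<omega>_def using ind_mult_cong by (simp add: zeta_power_eq_iff flip: power_add)

lemma omega_eq_iff:
  assumes "\<not> q dvd m" "\<not> q dvd n"
  shows "\<omega> m = \<omega> n \<longleftrightarrow> [m = n] (mod q)"
  using assms by (simp add: \<omega>_def zeta_power_eq_iff cong_def[of _ _ "q - 1"] ind_less ind_eq_iff)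

lemma omega_1 [simp]: "\<omega> 1 = 1"
proof -
  have "\<omega> 1 * \<omega> 1 = \<omega> 1 * 1" using omega_mult[of 1 1] q_gt_1 by simp
  then show ?thesis by (simp only: mult_cancel_left omega_nonzero simp_thms)
qed

definition chi :: "nat \<Rightarrow> nat \<Rightarrow> complex" where
  "chi k n = (if q dvd n then 0 else \<omega> n ^ k)"

lemma chi_cong: "[m = n] (mod q) \<Longrightarrow> chi k m = chi k n"
  by (metis chi_def cong_dvd_iff omega_eq_iff)

lemma chi_1 [simp]: "chi k 1 = 1"
  using q_gt_1 by (simp add: chi_def)

lemma chi_mult: "chi k (m * n) = chi k m * chi k n"
  using prime_q by (simp add: chi_def prime_dvd_mult_iff omega_mult power_mult_distrib)

lemma norm_chi_le: "norm (chi k n) \<le> 1"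
  by (simp add: chi_def norm_power)

lemma chi_conj:
  assumes "k < q - 1"
  shows "chi (q - 1 - k) n = cnj (chi k n)"
proof -
  have "\<omega> n ^ (q - 1 - k) * \<omega> n ^ k = cnj (\<omega> n) ^ k * \<omega> n ^ k"
    using assms
    by (simp add: cnj_omega_mult_omega omega_power_order flip: power_add power_mult_distrib)
  then show ?thesis by (simp add: chi_def)
qed

lemma sum_chi_period:
  assumes "0 < k" "k < q - 1"
  shows "(\<Sum>n<q. chi k n) = 0"
proof -
  have "(\<Sum>n<q. chi k n) = (\<Sum>n\<in>{0<..<q}. (\<zeta> ^ ind n) ^ k)"
    by (intro sum.mono_neutral_cong_right) (auto simp: chi_def \<omega>_def dest: dvd_imp_le)
  also have "\<dots> = (\<Sum>i<q - 1. (\<zeta> ^ i) ^ k)"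
    by (rule sum.reindex_bij_betw[OF bij_betw_ind])
  also have "\<dots> = (\<Sum>i<q - 1. (\<zeta> ^ k) ^ i)"
    by (simp add: mult.commute flip: power_mult)
  also have "\<dots> = 0"
  proof -
    have "(\<zeta> ^ k) ^ (q - 1) = 1" by (metis mult.commute power_mult power_one zeta_power_order)
    moreover have "\<zeta> ^ k \<noteq> 1" using zeta_power_eq_iff[of k 0] assms by (simp add: cong_def)
    ultimately show ?thesis by (simp add: sum_powers_root_of_unity)
  qed
  finally show ?thesis .
qed

lemma bounded_character_chi:
  assumes "0 < k" "k < q - 1"
  shows "bounded_character (chi k) (real q)"
proof
  show "norm (\<Sum>n=M..<N. chi k n) \<le> real q" for M N
    using q_gt_1
    by (intro norm_sum_periodic_le sum_chi_period norm_chi_le assms chi_cong) (simp_all add: cong_def)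
qed (simp_all add: chi_mult norm_chi_le)

lemma orthogonality:
  assumes not_dvd: "\<not> q dvd a"
  shows "(\<Sum>k<q - 1. cnj (chi k a) * chi k n) = of_nat (q - 1) * of_bool [n = a] (mod q)"
proof (cases "q dvd n")
  case True
  then have "\<not> [n = a] (mod q)" using not_dvd cong_dvd_iff by blast
  then show ?thesis using True by (simp add: chi_def)
next
  case False
  define u where "u = cnj (\<omega> a) * \<omega> n"
  have "u ^ (q - 1) = cnj (\<omega> a ^ (q - 1)) * \<omega> n ^ (q - 1)" by (simp add: u_def power_mult_distrib)
  then have "u ^ (q - 1) = 1" by (simp add: omega_power_order)
  moreover have "u = 1 \<longleftrightarrow> [n = a] (mod q)"
  proof -
    have "u = 1 \<longleftrightarrow> cnj (\<omega> a) * \<omega> n = cnj (\<omega> a) * \<omega> a" by (simp only: u_def cnj_omega_mult_omega)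
    also have "\<dots> \<longleftrightarrow> \<omega> n = \<omega> a" by simp
    finally show ?thesis using not_dvd False by (simp add: omega_eq_iff)
  qed
  moreover have "(\<Sum>k<q - 1. cnj (chi k a) * chi k n) = (\<Sum>k<q - 1. u ^ k)"
    using not_dvd False by (simp add: chi_def u_def power_mult_distrib)
  ultimately show ?thesis by (simp add: sum_powers_root_of_unity)
qed

lemma chi_half_values:
  assumes "2 * k = q - 1"
  shows "chi k n \<in> {-1, 0, 1}"
proof -
  have "(\<omega> n ^ k)\<^sup>2 = \<omega> n ^ (2 * k)" by (simp add: mult.commute flip: power_mult)
  also have "\<dots> = 1" by (simp only: assms omega_power_order)
  finally show ?thesis by (auto simp: chi_def power2_eq_1_iff)
qed

abbreviation chi_mertens :: "nat \<Rightarrow> nat \<Rightarrow> complex" where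
  "chi_mertens k \<equiv> mertens_sum (chi k)"

lemma chi_mertens_conj:
  assumes "k < q - 1"
  shows "chi_mertens (q - 1 - k) N = cnj (chi_mertens k N)"
proof -
  have "cnj (mangoldt n) = mangoldt n" for n
    by (metis of_real_mangoldt complex_cnj_complex_of_real)
  then show ?thesis unfolding mertens_sum_def chi_conj[OF assms] by simp
qed

lemma sum_cnj_chi_mult_chi_mertens:
  assumes "\<not> q dvd a"
  shows "(\<Sum>k<q - 1. cnj (chi k a) * chi_mertens k N) =
    of_real (real (q - 1) * mertens_sum (\<lambda>n. of_bool [n = a] (mod q)) N)"
proof -
  have "(\<Sum>k<q - 1. cnj (chi k a) * chi_mertens k N) =
    (\<Sum>n=1..N. (\<Sum>k<q - 1. cnj (chi k a) * chi k n) * mangoldt n / of_nat n)"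
    unfolding mertens_sum_def sum_distrib_left sum_distrib_right sum_divide_distrib
    by (subst sum.swap) (simp add: mult.assoc)
  also have "\<dots> = of_real (real (q - 1) * mertens_sum (\<lambda>n. of_bool [n = a] (mod q)) N)"
    unfolding orthogonality[OF assms] mertens_sum_def sum_distrib_left of_real_sum
    by (intro sum.cong) auto
  finally show ?thesis .
qed

lemma Re_sum_chi_mertens_nonneg: "0 \<le> Re (\<Sum>k<q - 1. chi_mertens k N)"
proof -
  have "(\<Sum>k<q - 1. chi_mertens k N) =
      of_real (real (q - 1) * mertens_sum (\<lambda>n. of_bool [n = 1] (mod q)) N)"
    using sum_cnj_chi_mult_chi_mertens[of 1 N] q_gt_1 by simp
  then show ?thesis
    by (simp only: Re_complex_of_real) (simp add: mertens_sum_nonneg)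
qed

lemma Re_chi_mertens_0: "Re (chi_mertens 0 N) = mertens_sum (\<lambda>n. of_bool (\<not> q dvd n)) N"
  unfolding mertens_sum_def Re_sum by (intro sum.cong) (auto simp: chi_def)

lemma Re_chi_mertens_0_le:
  assumes "N > 0"
  shows "Re (chi_mertens 0 N) \<le> ln (real N) + 4"
proof -
  have "Re (chi_mertens 0 N) \<le> mertens_sum (\<lambda>_. 1) N"
    unfolding Re_chi_mertens_0 by (intro mertens_sum_mono) simp
  with mertens_sum_1_le[OF assms] show ?thesis by linarith
qed

lemma Re_chi_mertens_0_ge:
  assumes "N > 0"
  shows "ln (real N) - 9 - ln (real q) \<le> Re (chi_mertens 0 N)"
proof -
  have "mertens_sum (\<lambda>_. 1::real) N \<le>
      mertens_sum (\<lambda>n. of_bool (\<not> q dvd n) + (of_bool (\<not> prime n) + of_bool (n = q))) N"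
    using prime_q by (intro mertens_sum_mono) (auto simp: of_bool_def dest: primes_dvd_imp_eq)
  also have "\<dots> \<le> Re (chi_mertens 0 N) + (8 + ln (real q))"
    unfolding mertens_sum_add Re_chi_mertens_0
  proof (intro add_left_mono add_mono mertens_sum_nonprime_le_8)
    have "mertens_sum (\<lambda>n. of_bool (n = q)) N = (\<Sum>n\<in>{1..N} \<inter> {q}. mangoldt n / real n)"
      unfolding mertens_sum_def by (rule sum.mono_neutral_cong_right) auto
    also have "\<dots> \<le> (\<Sum>n\<in>{q}. mangoldt n / real n)"
      by (intro sum_mono2) (auto simp: mangoldt_nonneg)
    also have "\<dots> \<le> ln (real q)"
      using q_gt_1 prime_q by (simp add: divide_le_eq mult_le_cancel_left1)
    finally show "mertens_sum (\<lambda>n. of_bool (n = q)) N \<le> ln (real q)" .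
  qed
  finally show ?thesis using mertens_sum_1_ge[OF assms] by linarith
qed

lemma Re_chi_mertens_le_of_L1_eq_0:
  assumes "0 < k" "k < q - 1" "L1 (chi k) = 0" "N > 0"
  shows "Re (chi_mertens k N) \<le> real q - ln (real N)"
proof -
  interpret bounded_character "chi k" "real q" by (rule bounded_character_chi) fact+
  have "Re (chi_mertens k N + of_real (ln (real N))) \<le> real q"
    using norm_mertens_sum_plus_ln_le[OF assms(3,4)] complex_Re_le_cmod order_trans by blast
  then show ?thesis by simp
qed

lemma Re_chi_mertens_bounded_above:
  obtains D where "\<And>k N. 0 < k \<Longrightarrow> k < q - 1 \<Longrightarrow> N > 0 \<Longrightarrow> Re (chi_mertens k N) \<le> D k"
proof -
  have "\<exists>C. \<forall>N>0. Re (chi_mertens k N) \<le> C" if k_range: "0 < k" "k < q - 1" for k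
  proof (cases "L1 (chi k) = 0")
    case True
    have "Re (chi_mertens k N) \<le> real q" if "N > 0" for N
    proof -
      have "ln (real N) \<ge> 0" using that by simp
      then show ?thesis using Re_chi_mertens_le_of_L1_eq_0[OF k_range True that] by linarith
    qed
    then show ?thesis by blast
  next
    case False
    interpret bounded_character "chi k" "real q" by (rule bounded_character_chi[OF k_range])
    obtain C where "norm (chi_mertens k N) \<le> C" for N using mertens_sum_bounded[OF False] by blast
    then show ?thesis using complex_Re_le_cmod order_trans by blast
  qed
  then show ?thesis using that by metis
qed

lemma L1_chi_half_nonzero:
  assumes k_half: "0 < k" "2 * k = q - 1"
  shows "L1 (chi k) \<noteq> 0"
proof -
  define \<rho> where "\<rho> n = Re (chi k n)" for n
  have chi_values: "chi k n \<in> {-1, 0, 1}" for n using k_half(2) by (rule chi_half_values)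
  have chi_eq: "chi k n = of_real (\<rho> n)" for n using chi_values[of n] by (auto simp: \<rho>_def)
  interpret bounded_character "chi k" "real q" using k_half by (intro bounded_character_chi) auto
  interpret \<rho>: real_character \<rho> "real q"
  proof
    show "\<rho> 1 = 1" by (simp add: \<rho>_def)
    show "\<rho> (m * n) = \<rho> m * \<rho> n" for m n
      using chi_mult[of m n] unfolding chi_eq by (simp only: of_real_eq_iff flip: of_real_mult)
    show "norm (\<rho> n) \<le> 1" for n using norm_chi_le[of n] unfolding chi_eq by simp
    show "norm (\<Sum>n=M..<N. \<rho> n) \<le> real q" for M N
      using norm_sum_chi_le[of M N]
      unfolding chi_eq by (simp only: norm_of_real real_norm_def flip: of_real_sum)
    show "\<rho> n \<in> {-1, 0, 1}" for n using chi_values[of n] by (auto simp: \<rho>_def)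
  qed
  have "L1 (chi k) = of_real (L1 \<rho>)"
    using suminf_of_real[OF \<rho>.summable_L1, where ?'a = complex] by (simp add: L1_def chi_eq)
  with \<rho>.L1_nonzero show ?thesis by simp
qed

text \<open>
  If \<open>L(1, chi k)\<close> vanishes for a non-real character, then so does its conjugate, and the sum of
  all \<open>chi_mertens k N\<close>, which is nonnegative by orthogonality, would be at most \<open>- ln N + O(1)\<close>.
\<close>

lemma L1_chi_nonzero:
  assumes k_range: "0 < k" "k < q - 1"
  shows "L1 (chi k) \<noteq> 0"
proof (cases "2 * k = q - 1")
  case True
  then show ?thesis by (intro L1_chi_half_nonzero k_range)
next
  case False
  show ?thesis
  proof
    assume L1_eq_0: "L1 (chi k) = 0"
    obtain D where Re_chi_mertens_le: "\<And>j N. 0 < j \<Longrightarrow> j < q - 1 \<Longrightarrow> N > 0 \<Longrightarrow> Re (chi_mertens j N) \<le> D j"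
      using Re_chi_mertens_bounded_above by blast
    define k' where "k' = q - 1 - k"
    have k'_range: "0 < k'" "k' < q - 1" "k' \<noteq> k" using k_range False by (auto simp: k'_def)
    define J where "J = {..<q - 1} - {0, k, k'}"
    have ln_le: "ln (real N) \<le> 4 + 2 * real q + (\<Sum>j\<in>J. D j)" if N_pos: "N > 0" for N
    proof -
      have "0 \<le> Re (\<Sum>j<q - 1. chi_mertens j N)" by (rule Re_sum_chi_mertens_nonneg)
      also have "{..<q - 1} = insert 0 (insert k (insert k' J))"
        using k_range k'_range by (auto simp: J_def)
      also have "Re (\<Sum>j\<in>\<dots>. chi_mertens j N) =
          Re (chi_mertens 0 N) + (Re (chi_mertens k N) + (Re (chi_mertens k' N) +
            (\<Sum>j\<in>J. Re (chi_mertens j N))))"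
        using k_range k'_range by (simp add: J_def)
      also have "Re (chi_mertens k' N) = Re (chi_mertens k N)"
        using chi_mertens_conj[OF k_range(2)] by (simp add: k'_def)
      also have "(\<Sum>j\<in>J. Re (chi_mertens j N)) \<le> (\<Sum>j\<in>J. D j)"
        using N_pos by (intro sum_mono Re_chi_mertens_le) (auto simp: J_def)
      finally show ?thesis
        using Re_chi_mertens_le_of_L1_eq_0[OF k_range L1_eq_0 N_pos] Re_chi_mertens_0_le[OF N_pos]
        by linarith
    qed
    obtain N where "N > 0" "ln (real N) > 4 + 2 * real q + (\<Sum>j\<in>J. D j)"
      using ex_ln_nat_gt by blast
    with ln_le[of N] show False by linarith
  qed
qed

lemma mertens_sum_progression_ge:
  assumes not_dvd: "\<not> q dvd a"
  obtains C where "\<And>N. N > 0 \<Longrightarrow>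
    ln (real N) - C \<le> real (q - 1) * mertens_sum (\<lambda>n. of_bool [n = a] (mod q)) N"
proof -
  have "\<exists>C. \<forall>N. norm (chi_mertens k N) \<le> C" if "k \<in> {0<..<q - 1}" for k
  proof -
    have k_range: "0 < k" "k < q - 1" using that by auto
    interpret bounded_character "chi k" "real q" by (rule bounded_character_chi[OF k_range])
    show ?thesis using mertens_sum_bounded[OF L1_chi_nonzero[OF k_range]] by metis
  qed
  then obtain D where norm_chi_mertens_le: "\<And>k N. k \<in> {0<..<q - 1} \<Longrightarrow> norm (chi_mertens k N) \<le> D k"
    by metis
  have "ln (real N) - (9 + ln (real q) + (\<Sum>k\<in>{0<..<q - 1}. D k)) \<le>
      real (q - 1) * mertens_sum (\<lambda>n. of_bool [n = a] (mod q)) N" if N_pos: "N > 0" for N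
  proof -
    have "- D k \<le> Re (cnj (chi k a) * chi_mertens k N)" if "k \<in> {0<..<q - 1}" for k
    proof -
      have "\<bar>Re (cnj (chi k a) * chi_mertens k N)\<bar> \<le> norm (chi k a) * norm (chi_mertens k N)"
        using abs_Re_le_cmod[of "cnj (chi k a) * chi_mertens k N"] by (simp add: norm_mult)
      also have "\<dots> \<le> 1 * D k" by (intro mult_mono norm_chi_le norm_chi_mertens_le that) auto
      finally show ?thesis by linarith
    qed
    then have "Re (chi_mertens 0 N) + (\<Sum>k\<in>{0<..<q - 1}. - D k) \<le>
        Re (chi_mertens 0 N) + (\<Sum>k\<in>{0<..<q - 1}. Re (cnj (chi k a) * chi_mertens k N))"
      by (intro add_left_mono sum_mono)
    also have "\<dots> = Re (\<Sum>k\<in>insert 0 {0<..<q - 1}. cnj (chi k a) * chi_mertens k N)"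
      using not_dvd by (simp add: chi_def)
    also have "insert 0 {0<..<q - 1} = {..<q - 1}" using q_gt_1 by auto
    also have "Re (\<Sum>k<q - 1. cnj (chi k a) * chi_mertens k N) =
        real (q - 1) * mertens_sum (\<lambda>n. of_bool [n = a] (mod q)) N"
      by (simp only: sum_cnj_chi_mult_chi_mertens[OF not_dvd] Re_complex_of_real)
    finally show ?thesis using Re_chi_mertens_0_ge[OF N_pos] by (simp add: sum_negf)
  qed
  then show ?thesis using that by blast
qed

end

lemma summable_imp_sum_ln_le:
  fixes f :: "nat \<Rightarrow> real"
  assumes summable: "summable f" and nonneg: "\<And>n. f n \<ge> 0" and "e > 0"
  obtains C where "\<And>N. N > 0 \<Longrightarrow> (\<Sum>n=1..N. f n * ln (real n)) \<le> e * ln (real N) + C"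
proof -
  obtain m where tail_small: "\<And>n. norm (sum f {m..<n}) < e"
    using summable \<open>e > 0\<close> unfolding summable_Cauchy by blast
  have terms_nonneg: "0 \<le> f n * ln (real n)" for n using nonneg by (cases "n = 0") auto
  have "(\<Sum>n=1..N. f n * ln (real n)) \<le> e * ln (real N) + (\<Sum>n<m. f n * ln (real n))"
    if N_pos: "N > 0" for N
  proof -
    have "(\<Sum>n=1..N. f n * ln (real n)) \<le> (\<Sum>n\<in>{m..<Suc N} \<union> {..<m}. f n * ln (real n))"
      by (intro sum_mono2 terms_nonneg) auto
    also have "\<dots> = (\<Sum>n\<in>{m..<Suc N}. f n * ln (real n)) + (\<Sum>n<m. f n * ln (real n))"
      by (rule sum.union_disjoint) auto
    also have "(\<Sum>n\<in>{m..<Suc N}. f n * ln (real n)) \<le> (\<Sum>n\<in>{m..<Suc N}. f n * ln (real N))"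
    proof (intro sum_mono mult_left_mono nonneg)
      fix n assume "n \<in> {m..<Suc N}"
      then show "ln (real n) \<le> ln (real N)" using N_pos by (cases "n = 0") auto
    qed
    also have "\<dots> = sum f {m..<Suc N} * ln (real N)" by (rule sum_distrib_right [symmetric])
    also have "\<dots> \<le> e * ln (real N)"
      using tail_small[of "Suc N"] N_pos by (intro mult_right_mono) auto
    finally show ?thesis by simp
  qed
  then show ?thesis using that by blast
qed

theorem not_summable_inverse_primes_progression:
  assumes prime: "prime q" and not_dvd: "\<not> q dvd a"
  shows "\<not> summable (\<lambda>p. of_bool (prime p \<and> [p = a] (mod q)) / real p)" (is "\<not> summable ?f")
proof
  assume "summable ?f"
  obtain g where "residue_primroot q g"
    using prime_primitive_root_exists[of q] prime prime_gt_1_nat[OF prime] by auto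
  then interpret prime_modulus q g using prime by unfold_locales
  obtain C where progression_ge: "\<And>N. N > 0 \<Longrightarrow>
    ln (real N) - C \<le> real (q - 1) * mertens_sum (\<lambda>n. of_bool [n = a] (mod q)) N"
    using mertens_sum_progression_ge[OF not_dvd] by blast
  define r where "r = real (q - 1)"
  have r_pos: "r > 0" using q_gt_1 by (simp add: r_def)
  obtain D where sum_ln_le: "\<And>N. N > 0 \<Longrightarrow> (\<Sum>p=1..N. ?f p * ln (real p)) \<le>
      1 / (2 * r) * ln (real N) + D"
    using summable_imp_sum_ln_le[OF \<open>summable ?f\<close>, of "1 / (2 * r)"] r_pos by auto
  have "ln (real N) \<le> 2 * (C + r * (8 + D))" if N_pos: "N > 0" for N
  proof -
    have "mertens_sum (\<lambda>n. of_bool [n = a] (mod q)) N \<le>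
        (mertens_sum (\<lambda>n. of_bool (\<not> prime n) + of_bool (prime n \<and> [n = a] (mod q))) N :: real)"
      by (intro mertens_sum_mono) auto
    also have "\<dots> \<le> 8 + (\<Sum>p=1..N. ?f p * ln (real p))"
      unfolding mertens_sum_add
    proof (intro add_mono mertens_sum_nonprime_le_8)
      show "mertens_sum (\<lambda>n. of_bool (prime n \<and> [n = a] (mod q))) N \<le> (\<Sum>p=1..N. ?f p * ln (real p))"
        unfolding mertens_sum_def by (intro sum_mono) auto
    qed
    also have "\<dots> \<le> 8 + (1 / (2 * r) * ln (real N) + D)" by (intro add_left_mono sum_ln_le N_pos)
    finally have "r * mertens_sum (\<lambda>n. of_bool [n = a] (mod q)) N \<le>
        r * (8 + (1 / (2 * r) * ln (real N) + D))"
      using r_pos by (intro mult_left_mono) auto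
    also have "\<dots> = ln (real N) / 2 + r * (8 + D)" using r_pos by (simp add: field_simps)
    finally show ?thesis using progression_ge[OF N_pos] by (simp add: r_def)
  qed
  moreover obtain N where "N > 0" "ln (real N) > 2 * (C + r * (8 + D))"
    using ex_ln_nat_gt by blast
  ultimately show False by (meson not_less)
qed

definition reciprocal_sum :: "nat set \<Rightarrow> real" where
  "reciprocal_sum A = (\<Sum>n\<in>A. 1 / real n)"

corollary ex_primes_progression_sum_inverse_ge:
  assumes "prime q" "\<not> q dvd a"
  obtains F where "finite F" "\<And>p. p \<in> F \<Longrightarrow> prime p \<and> [p = a] (mod q) \<and> p > z"
    "X \<le> reciprocal_sum F"
proof -
  let ?P = "\<lambda>p. prime p \<and> [p = a] (mod q)"
  let ?f = "\<lambda>p. of_bool (?P p) / real p"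
  have "\<exists>N. X + (\<Sum>p\<le>z. ?f p) < (\<Sum>p<N. ?f p)"
  proof (rule ccontr)
    assume "\<not> ?thesis"
    then have "summable ?f"
      by (intro summableI_nonneg_bounded[where x = "X + (\<Sum>p\<le>z. ?f p)"]) (auto simp: not_less)
    then show False using not_summable_inverse_primes_progression[OF assms] by blast
  qed
  then obtain N where N_large: "X + (\<Sum>p\<le>z. ?f p) < (\<Sum>p<N. ?f p)" ..
  define F where "F = {p \<in> {z<..<N}. ?P p}"
  have "(\<Sum>p<N. ?f p) \<le> (\<Sum>p\<in>{z<..<N} \<union> {..z}. ?f p)" by (intro sum_mono2) auto
  also have "\<dots> = (\<Sum>p\<in>{z<..<N}. ?f p) + (\<Sum>p\<le>z. ?f p)" by (rule sum.union_disjoint) auto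
  also have "(\<Sum>p\<in>{z<..<N}. ?f p) = reciprocal_sum F"
    unfolding F_def reciprocal_sum_def by (intro sum.mono_neutral_cong_right) auto
  finally show ?thesis using N_large by (intro that[of F]) (auto simp: F_def)
qed

section \<open>Sets of small density\<close>

definition density_at_most :: "nat set \<Rightarrow> real \<Rightarrow> bool" where
  "density_at_most A e \<longleftrightarrow> (\<exists>C. \<forall>N. real (card (A \<inter> {1..N})) \<le> e * real N + C)"

lemma density_at_mostI: "(\<And>N. real (card (A \<inter> {1..N})) \<le> e * real N + C) \<Longrightarrow> density_at_most A e"
  unfolding density_at_most_def by blast

lemma density_at_most_mono:
  assumes "density_at_most B e" "A \<inter> {1..} \<subseteq> B" "e \<le> e'"
  shows "density_at_most A e'"
proof -
  obtain C where bound: "\<And>N. real (card (B \<inter> {1..N})) \<le> e * real N + C"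
    using assms(1) unfolding density_at_most_def by blast
  show ?thesis
  proof (rule density_at_mostI)
    fix N
    have "card (A \<inter> {1..N}) \<le> card (B \<inter> {1..N})" using assms(2) by (intro card_mono) auto
    then have "real (card (A \<inter> {1..N})) \<le> e * real N + C" using bound[of N] by linarith
    also have "\<dots> \<le> e' * real N + C" using assms(3) by (intro add_right_mono mult_right_mono) auto
    finally show "real (card (A \<inter> {1..N})) \<le> e' * real N + C" .
  qed
qed

lemma density_at_most_Un:
  assumes "density_at_most A a" "density_at_most B b"
  shows "density_at_most (A \<union> B) (a + b)"
proof -
  obtain C D where bound_A: "\<And>N. real (card (A \<inter> {1..N})) \<le> a * real N + C"
    and bound_B: "\<And>N. real (card (B \<inter> {1..N})) \<le> b * real N + D"
    using assms unfolding density_at_most_def by blast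
  show ?thesis
  proof (rule density_at_mostI)
    fix N
    have "card ((A \<union> B) \<inter> {1..N}) \<le> card (A \<inter> {1..N}) + card (B \<inter> {1..N})"
      using card_Un_le[of "A \<inter> {1..N}" "B \<inter> {1..N}"] by (simp add: Int_Un_distrib2)
    then show "real (card ((A \<union> B) \<inter> {1..N})) \<le> (a + b) * real N + (C + D)"
      using bound_A[of N] bound_B[of N] by (simp add: distrib_right)
  qed
qed

lemma density_at_most_empty: "density_at_most {} 0"
  by (rule density_at_mostI[where C = 0]) simp

lemma density_at_most_UN:
  assumes "finite I" "\<And>i. i \<in> I \<Longrightarrow> density_at_most (A i) e"
  shows "density_at_most (\<Union>i\<in>I. A i) (real (card I) * e)"
  using assms
proof (induction I rule: finite_induct)
  case empty
  show ?case using density_at_most_empty by simp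
next
  case (insert i I)
  then have "density_at_most (A i \<union> (\<Union>i\<in>I. A i)) (e + real (card I) * e)"
    by (intro density_at_most_Un) auto
  then show ?case using insert by (simp add: distrib_right)
qed

lemma density_at_most_markov:
  fixes f :: "nat \<Rightarrow> real"
  assumes nonneg: "\<And>n. f n \<ge> 0" and mean: "\<And>N. (\<Sum>n=1..N. f n) \<le> c * real N + C" and "t > 0"
  shows "density_at_most {n. t \<le> f n} (c / t)"
proof (rule density_at_mostI)
  fix N
  let ?A = "{n. t \<le> f n} \<inter> {1..N}"
  have "t * real (card ?A) = (\<Sum>n\<in>?A. t)" by simp
  also have "\<dots> \<le> (\<Sum>n\<in>?A. f n)" by (intro sum_mono) auto
  also have "\<dots> \<le> (\<Sum>n=1..N. f n)" using nonneg by (intro sum_mono2) auto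
  also have "\<dots> \<le> c * real N + C" by (rule mean)
  finally show "real (card ?A) \<le> c / t * real N + C / t" using \<open>t > 0\<close> by (simp add: field_simps)
qed

lemma density_at_most_inj_quotient:
  assumes inj: "inj_on f A" and z_pos: "z > 0" and quotient: "\<And>n. n \<in> A \<Longrightarrow> 0 < f n \<and> z * f n \<le> n"
  shows "density_at_most A (1 / real z)"
proof (rule density_at_mostI)
  fix N
  have "f ` (A \<inter> {1..N}) \<subseteq> {1..N div z}"
  proof
    fix m assume "m \<in> f ` (A \<inter> {1..N})"
    then have "0 < m" "z * m \<le> N" using quotient by fastforce+
    then show "m \<in> {1..N div z}" using z_pos by (simp add: less_eq_div_iff_mult_less_eq mult.commute)
  qed
  then have "card (f ` (A \<inter> {1..N})) \<le> card {1..N div z}" by (intro card_mono) auto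
  then have "card (A \<inter> {1..N}) \<le> N div z"
    using inj by (subst (asm) card_image) (auto intro: inj_on_subset)
  then have "real (card (A \<inter> {1..N})) \<le> real (N div z)" by (rule of_nat_mono)
  also have "\<dots> \<le> real N / real z" by (rule of_nat_div_le_of_nat)
  finally show "real (card (A \<inter> {1..N})) \<le> 1 / real z * real N + 0" by simp
qed

section \<open>Prime divisors of almost all integers\<close>

lemma sum_of_bool_dvd:
  assumes "d > 0"
  shows "(\<Sum>n=1..N. of_bool (d dvd n)) = real (N div d)"
proof -
  have "{n \<in> {1..N}. d dvd n} = (\<lambda>k. d * k) ` {1..N div d}"
    using assms
    by (auto simp: less_eq_div_iff_mult_less_eq Suc_le_eq mult.commute elim!: dvdE intro: Nat.gr0I)
  then have "card {n \<in> {1..N}. d dvd n} = N div d"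
    using assms by (simp add: card_image inj_on_def)
  then show ?thesis by (simp add: of_bool_def flip: sum.inter_filter)
qed

definition count_dividing :: "nat set \<Rightarrow> nat \<Rightarrow> real" where
  "count_dividing F n = (\<Sum>p\<in>F. of_bool (p dvd n))"

lemma sum_count_dividing_ge:
  assumes pos: "\<And>p. p \<in> F \<Longrightarrow> p > 0"
  shows "real N * reciprocal_sum F - real (card F) \<le> (\<Sum>n=1..N. count_dividing F n)"
proof -
  have "real N * reciprocal_sum F - real (card F) = (\<Sum>p\<in>F. real N * (1 / real p) - 1)"
    by (simp only: reciprocal_sum_def sum_subtractf flip: sum_distrib_left) simp
  also have "\<dots> \<le> (\<Sum>p\<in>F. real (N div p))"
  proof (rule sum_mono)
    fix p assume "p \<in> F"
    then have "real N / real p \<le> real (Suc (N div p))" using pos real_divide_le_Suc_div by blast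
    then show "real N * (1 / real p) - 1 \<le> real (N div p)" by simp
  qed
  also have "\<dots> = (\<Sum>p\<in>F. \<Sum>n=1..N. of_bool (p dvd n))"
    using pos by (intro sum.cong refl sum_of_bool_dvd [symmetric])
  also have "\<dots> = (\<Sum>n=1..N. count_dividing F n)" unfolding count_dividing_def by (rule sum.swap)
  finally show ?thesis .
qed

lemma sum_of_bool_dvd_both_le:
  assumes "prime p" "prime r"
  shows "(\<Sum>n=1..N. of_bool (p dvd n) * of_bool (r dvd n)) \<le>
    real N * (1 / real p * (1 / real r) + of_bool (r = p) / real p)"
proof (cases "r = p")
  case True
  have "(\<Sum>n=1..N. of_bool (p dvd n) * of_bool (r dvd n)) = (\<Sum>n=1..N. of_bool (p dvd n) :: real)"
    using True by simp
  also have "\<dots> = real (N div p)" using assms prime_gt_0_nat by (intro sum_of_bool_dvd)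
  also have "\<dots> \<le> real N * (0 + 1 / real p)"
    using of_nat_div_le_of_nat[of N p, where ?'a = real] by simp
  also have "\<dots> \<le> real N * (1 / real p * (1 / real r) + of_bool (r = p) / real p)"
    using True by (intro mult_left_mono add_right_mono) auto
  finally show ?thesis .
next
  case False
  have "p dvd n \<and> r dvd n \<longleftrightarrow> p * r dvd n" for n
    using assms False by (auto intro: divides_mult primes_coprime dest: dvd_mult_left dvd_mult_right)
  then have "(\<Sum>n=1..N. of_bool (p dvd n) * of_bool (r dvd n)) =
      (\<Sum>n=1..N. of_bool (p * r dvd n) :: real)"
    by (simp flip: of_bool_conj)
  also have "\<dots> = real (N div (p * r))"
    using assms by (intro sum_of_bool_dvd) (simp add: prime_gt_0_nat)
  also have "\<dots> \<le> real N / real (p * r)" by (rule of_nat_div_le_of_nat)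
  finally show ?thesis using False by simp
qed

lemma sum_count_dividing_squared_le:
  assumes fin: "finite F" and prime: "\<And>p. p \<in> F \<Longrightarrow> prime p"
  shows "(\<Sum>n=1..N. (count_dividing F n)\<^sup>2) \<le> real N * ((reciprocal_sum F)\<^sup>2 + reciprocal_sum F)"
proof -
  have "(\<Sum>n=1..N. (count_dividing F n)\<^sup>2) =
      (\<Sum>n=1..N. \<Sum>p\<in>F. \<Sum>r\<in>F. of_bool (p dvd n) * of_bool (r dvd n))"
    by (simp only: count_dividing_def power2_eq_square sum_product)
  also have "\<dots> = (\<Sum>p\<in>F. \<Sum>n=1..N. \<Sum>r\<in>F. of_bool (p dvd n) * of_bool (r dvd n))"
    by (rule sum.swap)
  also have "\<dots> = (\<Sum>p\<in>F. \<Sum>r\<in>F. \<Sum>n=1..N. of_bool (p dvd n) * of_bool (r dvd n))"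
    by (intro sum.cong refl sum.swap)
  also have "\<dots> \<le> (\<Sum>p\<in>F. \<Sum>r\<in>F. real N * (1 / real p * (1 / real r) + of_bool (r = p) / real p))"
    by (intro sum_mono sum_of_bool_dvd_both_le prime)
  also have "\<dots> = real N *
      (\<Sum>p\<in>F. (\<Sum>r\<in>F. 1 / real p * (1 / real r)) + (\<Sum>r\<in>F. of_bool (r = p) / real p))"
    by (simp only: sum.distrib flip: sum_distrib_left)
  also have "(\<Sum>p\<in>F. (\<Sum>r\<in>F. 1 / real p * (1 / real r)) + (\<Sum>r\<in>F. of_bool (r = p) / real p)) =
      (\<Sum>p\<in>F. \<Sum>r\<in>F. 1 / real p * (1 / real r)) + (\<Sum>p\<in>F. 1 / real p)"
    using fin by (simp add: sum.distrib of_bool_def if_distrib[of "\<lambda>x. x / _"] cong: if_cong)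
  also have "\<dots> = (reciprocal_sum F)\<^sup>2 + reciprocal_sum F"
    by (simp only: reciprocal_sum_def power2_eq_square sum_product)
  finally show ?thesis .
qed

lemma sum_count_dividing_deviation_le:
  assumes fin: "finite F" and prime: "\<And>p. p \<in> F \<Longrightarrow> prime p"
  shows "(\<Sum>n=1..N. (count_dividing F n - reciprocal_sum F)\<^sup>2) \<le>
    reciprocal_sum F * real N + 2 * reciprocal_sum F * real (card F)"
proof -
  define A where "A = reciprocal_sum F"
  have A_nonneg: "A \<ge> 0" by (simp add: A_def reciprocal_sum_def sum_nonneg)
  have "(\<Sum>n=1..N. (count_dividing F n - A)\<^sup>2) =
      (\<Sum>n=1..N. (count_dividing F n)\<^sup>2) - 2 * A * (\<Sum>n=1..N. count_dividing F n) + real N * A\<^sup>2"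
    by (simp add: power2_diff sum.distrib sum_subtractf sum_distrib_left mult_ac)
  also have "\<dots> \<le> real N * (A\<^sup>2 + A) - 2 * A * (real N * A - real (card F)) + real N * A\<^sup>2"
    using A_nonneg sum_count_dividing_squared_le[OF fin prime] sum_count_dividing_ge[of F N]
      prime prime_gt_0_nat
    unfolding A_def by (intro add_mono diff_mono mult_left_mono) auto
  also have "\<dots> = A * real N + 2 * A * real (card F)" by (simp add: algebra_simps power2_eq_square)
  finally show ?thesis by (simp add: A_def)
qed

text \<open>Chebyshev's inequality: the number of prime divisors in \<open>F\<close> has mean and variance about
  \<open>reciprocal_sum F\<close>.\<close>

lemma density_at_most_no_prime_divisor_in:
  assumes fin: "finite F" and prime: "\<And>p. p \<in> F \<Longrightarrow> prime p" and pos: "reciprocal_sum F > 0"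
  shows "density_at_most {n. \<forall>p\<in>F. \<not> p dvd n} (1 / reciprocal_sum F)"
proof -
  let ?dev = "\<lambda>n. (count_dividing F n - reciprocal_sum F)\<^sup>2"
  have "density_at_most {n. (reciprocal_sum F)\<^sup>2 \<le> ?dev n} (reciprocal_sum F / (reciprocal_sum F)\<^sup>2)"
    using sum_count_dividing_deviation_le[OF fin prime] pos by (intro density_at_most_markov) auto
  then show ?thesis
    by (rule density_at_most_mono) (use pos in \<open>auto simp: count_dividing_def power2_eq_square\<close>)
qed

lemma sum_inverse_squares_tail_le:
  assumes "z > 0"
  shows "(\<Sum>d=Suc z..N. 1 / (real d)\<^sup>2) \<le> 1 / real z"
proof -
  have "(\<Sum>d=Suc z..N. 1 / (real d)\<^sup>2) \<le> 1 / real z - 1 / real N" if "N \<ge> z"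
    using that
  proof (induction N rule: dec_induct)
    case (step N)
    have "1 / (real (Suc N))\<^sup>2 \<le> 1 / (real N * real (Suc N))"
      using assms step unfolding power2_eq_square by (intro divide_left_mono mult_right_mono) auto
    also have "\<dots> = 1 / real N - 1 / real (Suc N)" using assms step by (simp add: field_simps)
    finally show ?case using step by simp
  qed simp
  then show ?thesis by (cases "N \<ge> z") (auto intro: order_trans)
qed

lemma density_at_most_square_divisor:
  assumes "z > 0"
  shows "density_at_most {n. \<exists>d>z. d\<^sup>2 dvd n} (1 / real z)"
proof -
  have "density_at_most {n. 1 \<le> (\<Sum>d\<in>{z<..n}. of_bool (d\<^sup>2 dvd n) :: real)} (1 / real z / 1)"
  proof (rule density_at_most_markov)
    fix N
    have "(\<Sum>n=1..N. \<Sum>d\<in>{z<..n}. of_bool (d\<^sup>2 dvd n) :: real) \<le>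
        (\<Sum>n=1..N. \<Sum>d=Suc z..N. of_bool (d\<^sup>2 dvd n))"
      by (intro sum_mono sum_mono2) auto
    also have "\<dots> = (\<Sum>d=Suc z..N. \<Sum>n=1..N. of_bool (d\<^sup>2 dvd n))" by (rule sum.swap)
    also have "\<dots> = (\<Sum>d=Suc z..N. real (N div d\<^sup>2))" by (intro sum.cong refl sum_of_bool_dvd) simp
    also have "\<dots> \<le> (\<Sum>d=Suc z..N. real N * (1 / (real d)\<^sup>2))"
    proof (rule sum_mono)
      fix d
      show "real (N div d\<^sup>2) \<le> real N * (1 / (real d)\<^sup>2)"
        using of_nat_div_le_of_nat[of N "d\<^sup>2", where ?'a = real] by simp
    qed
    also have "\<dots> \<le> real N * (1 / real z)"
      using sum_inverse_squares_tail_le[OF assms]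
      by (simp only: mult_left_mono of_nat_0_le_iff flip: sum_distrib_left)
    finally show "(\<Sum>n=1..N. \<Sum>d\<in>{z<..n}. of_bool (d\<^sup>2 dvd n) :: real) \<le> 1 / real z * real N + 0"
      by simp
  qed (auto intro: sum_nonneg)
  then show ?thesis
  proof (rule density_at_most_mono)
    show "{n. \<exists>d>z. d\<^sup>2 dvd n} \<inter> {1..} \<subseteq> {n. 1 \<le> (\<Sum>d\<in>{z<..n}. of_bool (d\<^sup>2 dvd n) :: real)}"
    proof
      fix n assume "n \<in> {n. \<exists>d>z. d\<^sup>2 dvd n} \<inter> {1..}"
      then obtain d where square_dvd: "d > z" "d\<^sup>2 dvd n" "n > 0" by auto
      have "d \<le> d\<^sup>2" by (simp add: power2_eq_square)
      also have "\<dots> \<le> n" using square_dvd by (intro dvd_imp_le)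
      finally have "(\<Sum>d\<in>{d}. of_bool (d\<^sup>2 dvd n) :: real) \<le> (\<Sum>d\<in>{z<..n}. of_bool (d\<^sup>2 dvd n))"
        using square_dvd by (intro sum_mono2) auto
      then show "n \<in> {n. 1 \<le> (\<Sum>d\<in>{z<..n}. of_bool (d\<^sup>2 dvd n) :: real)}" using square_dvd by simp
    qed
  qed simp
qed

lemma density_at_most_large_prime_factors:
  assumes y_pos: "y > 0" and t_pos: "t > 0"
  shows "density_at_most {n. t \<le> reciprocal_sum {p \<in> prime_factors n. y < p}} (1 / real y / t)"
proof (rule density_at_most_markov[where C = 0])
  fix N
  have "reciprocal_sum {p \<in> prime_factors n. y < p} \<le> (\<Sum>d=Suc y..N. of_bool (d dvd n) / real d)"
    if n_range: "n \<in> {1..N}" for n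
  proof -
    have "reciprocal_sum {p \<in> prime_factors n. y < p} \<le> (\<Sum>d\<in>{d \<in> {Suc y..N}. d dvd n}. 1 / real d)"
      unfolding reciprocal_sum_def
      using n_range by (intro sum_mono2) (auto simp: in_prime_factors_iff dest: dvd_imp_le)
    also have "\<dots> = (\<Sum>d=Suc y..N. of_bool (d dvd n) / real d)"
      by (intro sum.mono_neutral_cong_left) auto
    finally show ?thesis .
  qed
  then have "(\<Sum>n=1..N. reciprocal_sum {p \<in> prime_factors n. y < p}) \<le>
      (\<Sum>n=1..N. \<Sum>d=Suc y..N. of_bool (d dvd n) / real d)"
    by (rule sum_mono)
  also have "\<dots> = (\<Sum>d=Suc y..N. (\<Sum>n=1..N. of_bool (d dvd n)) / real d)"
    unfolding sum_divide_distrib by (rule sum.swap)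
  also have "\<dots> = (\<Sum>d=Suc y..N. real (N div d) / real d)"
    by (intro sum.cong refl arg_cong2[where f = "(/)"] sum_of_bool_dvd) auto
  also have "\<dots> \<le> (\<Sum>d=Suc y..N. real N / real d / real d)"
    by (intro sum_mono divide_right_mono of_nat_div_le_of_nat) auto
  also have "\<dots> = real N * (\<Sum>d=Suc y..N. 1 / (real d)\<^sup>2)"
    by (simp add: sum_distrib_left power2_eq_square)
  also have "\<dots> \<le> real N * (1 / real y)"
    by (intro mult_left_mono sum_inverse_squares_tail_le y_pos) auto
  finally show "(\<Sum>n=1..N. reciprocal_sum {p \<in> prime_factors n. y < p}) \<le> 1 / real y * real N + 0"
    by simp
qed (use t_pos in \<open>auto simp: reciprocal_sum_def sum_nonneg\<close>)

section \<open>Persistence of small primes\<close>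

lemma T_add_self:
  assumes "n > 0"
  shows "T n + n = n div \<Prod>(prime_factors n) * (\<Prod>p\<in>prime_factors n. p + 1)"
proof -
  define P where "P = \<Prod>(prime_factors n)"
  have "n div P * P = n"
    using prod_prime_factors_dvd[OF assms] by (simp add: P_def)
  then have "real n = real (n div P) * real P" by (metis of_nat_mult)
  then have "real (T n + n) = real (n div P) * (real P * (\<Prod>p\<in>prime_factors n. 1 + 1 / real p))"
    by (simp add: of_nat_T dedekind_psi_def)
  also have "real P * (\<Prod>p\<in>prime_factors n. 1 + 1 / real p) =
      (\<Prod>p\<in>prime_factors n. real p * (1 + 1 / real p))"
    by (simp add: P_def prod.distrib)
  also have "\<dots> = (\<Prod>p\<in>prime_factors n. real (p + 1))"
    by (intro prod.cong) (auto simp: field_simps in_prime_factors_iff prime_gt_0_nat)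
  finally have "real (T n + n) = real (n div P * (\<Prod>p\<in>prime_factors n. p + 1))" by simp
  then show ?thesis unfolding P_def by (simp only: of_nat_eq_iff)
qed

lemma dvd_T:
  assumes q_dvd: "q dvd n" and shifted_prime: "prime p" "p dvd n" "q dvd p + 1"
  shows "q dvd T n"
proof (cases "n = 0")
  case True
  then show ?thesis by (simp add: T_def dedekind_psi_def)
next
  case False
  then have "p + 1 dvd (\<Prod>p\<in>prime_factors n. p + 1)"
    using shifted_prime by (intro dvd_prodI) (auto simp: in_prime_factors_iff)
  then have "q dvd T n + n"
    using shifted_prime False by (simp add: T_add_self dvd_mult dvd_trans[of q "p + 1"])
  with q_dvd show ?thesis by (simp add: dvd_add_left_iff)
qed

definition no_shifted_prime :: "nat \<Rightarrow> nat \<Rightarrow> nat set" where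
  "no_shifted_prime q z = {n. \<forall>p\<le>z. prime p \<and> p dvd n \<longrightarrow> \<not> q dvd p + 1}"

lemma density_at_most_no_shifted_prime:
  fixes q :: nat
  assumes prime_q: "prime q" and "e > 0"
  obtains z where "density_at_most (no_shifted_prime q z) e"
proof -
  have "\<not> q dvd q - 1" using prime_gt_1_nat[OF prime_q] by (intro nat_dvd_not_less) auto
  then obtain F where finite_F: "finite F"
    and F_primes: "\<And>p. p \<in> F \<Longrightarrow> prime p \<and> [p = q - 1] (mod q) \<and> p > 0"
    and F_sum: "1 / e \<le> reciprocal_sum F"
    using ex_primes_progression_sum_inverse_ge[OF prime_q] by metis
  have dvd_shifted: "q dvd p + 1" if "p \<in> F" for p
  proof -
    have "[p + 1 = q - 1 + 1] (mod q)" using F_primes[OF that] by (intro cong_add) auto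
    then show ?thesis using prime_gt_1_nat[OF prime_q] by (simp add: cong_def mod_eq_0_iff_dvd)
  qed
  have "0 < 1 / e" using \<open>e > 0\<close> by simp
  then have "reciprocal_sum F > 0" using F_sum by linarith
  then have "density_at_most {n. \<forall>p\<in>F. \<not> p dvd n} (1 / reciprocal_sum F)"
    using finite_F F_primes by (intro density_at_most_no_prime_divisor_in) auto
  then have "density_at_most (no_shifted_prime q (Max (insert 0 F))) e"
  proof (rule density_at_most_mono)
    show "1 / reciprocal_sum F \<le> e"
      using F_sum \<open>e > 0\<close> \<open>reciprocal_sum F > 0\<close> by (simp add: field_simps)
    have "p \<le> Max (insert 0 F)" if "p \<in> F" for p using finite_F that by simp
    then show "no_shifted_prime q (Max (insert 0 F)) \<inter> {1..} \<subseteq> {n. \<forall>p\<in>F. \<not> p dvd n}"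
      using F_primes dvd_shifted unfolding no_shifted_prime_def by blast
  qed
  then show ?thesis by (rule that)
qed

lemma density_at_most_no_shifted_prime_uniform:
  fixes y :: nat
  assumes "e > 0"
  obtains z where "density_at_most {n. \<exists>q\<le>y. prime q \<and> n \<in> no_shifted_prime q z} e"
proof -
  define I where "I = {q. prime q \<and> q \<le> y}"
  define e' where "e' = e / real (Suc (card I))"
  have "e' > 0" using assms by (simp add: e'_def)
  have "finite I" by (simp add: I_def)
  have "\<exists>z. density_at_most (no_shifted_prime q z) e'" if "q \<in> I" for q
    using density_at_most_no_shifted_prime[OF _ \<open>e' > 0\<close>, of q] that
    unfolding I_def by blast
  then obtain Z where density_Z: "\<And>q. q \<in> I \<Longrightarrow> density_at_most (no_shifted_prime q (Z q)) e'" by metis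
  define z where "z = Max (insert 0 (Z ` I))"
  have "Z q \<le> z" if "q \<in> I" for q using that \<open>finite I\<close> by (simp add: z_def)
  then have "no_shifted_prime q z \<subseteq> no_shifted_prime q (Z q)" if "q \<in> I" for q
    using that le_trans unfolding no_shifted_prime_def by blast
  then have "{n. \<exists>q\<le>y. prime q \<and> n \<in> no_shifted_prime q z} \<subseteq> (\<Union>q\<in>I. no_shifted_prime q (Z q))"
    by (auto simp: I_def)
  moreover have "density_at_most (\<Union>q\<in>I. no_shifted_prime q (Z q)) (real (card I) * e')"
    using \<open>finite I\<close> density_Z by (rule density_at_most_UN)
  moreover have "real (card I) * e' \<le> e" using assms by (simp add: e'_def field_simps)
  ultimately have "density_at_most {n. \<exists>q\<le>y. prime q \<and> n \<in> no_shifted_prime q z} e"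
    using density_at_most_mono by blast
  then show ?thesis by (rule that)
qed

lemma small_primes_persist:
  assumes "e > 0"
  obtains E where "density_at_most E e"
    "\<And>n j q. n \<notin> E \<Longrightarrow> j \<le> l \<Longrightarrow> q \<le> y \<Longrightarrow> prime q \<Longrightarrow> q dvd n \<Longrightarrow> q dvd (T ^^ j) n"
  using assms
proof (induction l arbitrary: y e thesis)
  case 0
  have "density_at_most {} e"
    using density_at_most_empty by (rule density_at_most_mono) (use 0(2) in auto)
  then show ?case using 0(1)[of "{}"] by auto
next
  case (Suc l)
  obtain z where density_D: "density_at_most {n. \<exists>q\<le>y. prime q \<and> n \<in> no_shifted_prime q z} (e / 2)"
    (is "density_at_most ?D _")
    using density_at_most_no_shifted_prime_uniform[of "e / 2" y] Suc.prems(2) by auto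
  obtain E where density_E: "density_at_most E (e / 2)"
    and persist: "\<And>n j q. n \<notin> E \<Longrightarrow> j \<le> l \<Longrightarrow> q \<le> max y z \<Longrightarrow> prime q \<Longrightarrow> q dvd n \<Longrightarrow> q dvd (T ^^ j) n"
    using Suc.IH[of "e / 2" "max y z"] Suc.prems(2) by auto
  have "q dvd (T ^^ j) n"
    if n_good: "n \<notin> E \<union> ?D" and j_le: "j \<le> Suc l" and prime_q: "q \<le> y" "prime q" "q dvd n" for n j q
  proof (cases "j \<le> l")
    case True
    then show ?thesis using persist n_good prime_q by auto
  next
    case False
    then have j_eq: "j = Suc l" using j_le by simp
    obtain p where prime_p: "p \<le> z" "prime p" "p dvd n" "q dvd p + 1"
      using n_good prime_q by (auto simp: no_shifted_prime_def)
    have "q dvd T ((T ^^ l) n)"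
      using persist[of n l] n_good prime_p prime_q by (intro dvd_T[of q _ p]) auto
    then show ?thesis by (simp add: j_eq)
  qed
  moreover have "density_at_most (E \<union> ?D) e" using density_at_most_Un[OF density_E density_D] by simp
  ultimately show ?case using Suc.prems(1) by blast
qed

section \<open>The distribution of the ratio of \<open>\<psi>(n)\<close> to \<open>n\<close>\<close>

definition psi_ratio :: "nat \<Rightarrow> real" where
  "psi_ratio n = (\<Prod>p\<in>prime_factors n. 1 + 1 / real p)"

definition psi_ratio_upto :: "nat \<Rightarrow> nat \<Rightarrow> real" where
  "psi_ratio_upto y n = (\<Prod>p | p \<in> prime_factors n \<and> p \<le> y. 1 + 1 / real p)"

lemma T_eq_psi_ratio: "real (T n) = real n * (psi_ratio n - 1)"
  by (simp add: of_nat_T dedekind_psi_def psi_ratio_def algebra_simps)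

lemma psi_ratio_upto_pos: "psi_ratio_upto y n > 0"
  unfolding psi_ratio_upto_def by (intro prod_pos) (auto intro: add_pos_nonneg)

lemma psi_ratio_upto_le_psi_ratio:
  assumes "m > 0" "\<And>q. q \<le> y \<Longrightarrow> prime q \<Longrightarrow> q dvd n \<Longrightarrow> q dvd m"
  shows "psi_ratio_upto y n \<le> psi_ratio m"
  unfolding psi_ratio_upto_def psi_ratio_def
  using assms by (intro prod_mono2) (auto simp: in_prime_factors_iff)

lemma psi_ratio_upto_prime_mult:
  assumes "prime p" "\<not> p dvd m" "p \<le> y"
  shows "psi_ratio_upto y (p * m) = (1 + 1 / real p) * psi_ratio_upto y m"
proof -
  have "m \<noteq> 0" using assms(2) by (metis dvd_0_right)
  then have "{r. r \<in> prime_factors (p * m) \<and> r \<le> y} = insert p {r. r \<in> prime_factors m \<and> r \<le> y}"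
    using assms by (auto simp: prime_factors_product prime_prime_factors)
  moreover have "p \<notin> {r. r \<in> prime_factors m \<and> r \<le> y}"
    using assms by (auto simp: in_prime_factors_iff)
  ultimately show ?thesis unfolding psi_ratio_upto_def by (simp only:) (subst prod.insert, auto)
qed

lemma psi_ratio_le_upto_mult_exp:
  "psi_ratio n \<le> psi_ratio_upto y n * exp (reciprocal_sum {p \<in> prime_factors n. y < p})"
proof -
  have "prime_factors n = {p \<in> prime_factors n. p \<le> y} \<union> {p \<in> prime_factors n. y < p}" by auto
  then have "psi_ratio n =
      (\<Prod>p\<in>{p \<in> prime_factors n. p \<le> y} \<union> {p \<in> prime_factors n. y < p}. 1 + 1 / real p)"
    unfolding psi_ratio_def by simp
  also have "\<dots> = psi_ratio_upto y n * (\<Prod>p | p \<in> prime_factors n \<and> y < p. 1 + 1 / real p)"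
    unfolding psi_ratio_upto_def by (rule prod.union_disjoint) auto
  also have "\<dots> \<le> psi_ratio_upto y n * (\<Prod>p | p \<in> prime_factors n \<and> y < p. exp (1 / real p))"
    using psi_ratio_upto_pos[of y n]
    by (intro mult_left_mono prod_mono) (auto intro: exp_ge_add_one_self add_nonneg_nonneg)
  finally show ?thesis by (simp add: exp_sum reciprocal_sum_def)
qed

lemma psi_ratio_upto_prime_mult_separated:
  assumes p_new: "prime p" "\<not> p dvd m" "p \<le> y" and r_new: "prime r" "\<not> r dvd m" "r \<le> y"
    and separated: "(1 + \<eta>) * (1 + 1 / real r) \<le> 1 + 1 / real p"
  shows "(1 + \<eta>) * psi_ratio_upto y (r * m) \<le> psi_ratio_upto y (p * m)"
proof -
  have "(1 + \<eta>) * psi_ratio_upto y (r * m) = (1 + \<eta>) * (1 + 1 / real r) * psi_ratio_upto y m"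
    using psi_ratio_upto_prime_mult[OF r_new] by simp
  also have "\<dots> \<le> (1 + 1 / real p) * psi_ratio_upto y m"
    using separated psi_ratio_upto_pos[of y m] by (intro mult_right_mono) auto
  also have "\<dots> = psi_ratio_upto y (p * m)"
    using psi_ratio_upto_prime_mult[OF p_new] by simp
  finally show ?thesis .
qed

definition psi_ratio_upto_just_below :: "real \<Rightarrow> real \<Rightarrow> nat \<Rightarrow> nat set" where
  "psi_ratio_upto_just_below \<eta> t y = {n. psi_ratio_upto y n \<le> t \<and> t < (1 + \<eta>) * psi_ratio_upto y n}"

text \<open>
  Removing a prime \<open>p \<in> F\<close> from \<open>n\<close> changes the ratio by the factor \<open>1 + 1 / p\<close>, and these
  factors are so well separated that \<open>n div p\<close> determines \<open>p\<close>.
\<close>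

lemma density_at_most_just_below_simple_prime:
  assumes F_primes: "\<And>p. p \<in> F \<Longrightarrow> prime p \<and> z < p \<and> p \<le> y" and z_pos: "z > 0"
    and separated: "\<And>p r. p \<in> F \<Longrightarrow> r \<in> F \<Longrightarrow> p < r \<Longrightarrow> (1 + \<eta>) * (1 + 1 / real r) \<le> 1 + 1 / real p"
  shows "density_at_most {n \<in> psi_ratio_upto_just_below \<eta> t y. \<exists>p\<in>F. p dvd n \<and> \<not> p\<^sup>2 dvd n}
    (1 / real z)"
    (is "density_at_most ?S _")
proof -
  define S where "S = ?S"
  have bounds: "psi_ratio_upto y n \<le> t" "t < (1 + \<eta>) * psi_ratio_upto y n" if "n \<in> S" for n
    using that by (auto simp: S_def psi_ratio_upto_just_below_def)
  have "\<exists>p. p \<in> F \<and> p dvd n \<and> \<not> p\<^sup>2 dvd n" if "n \<in> S" for n using that by (auto simp: S_def)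
  then obtain P where P_spec: "\<And>n. n \<in> S \<Longrightarrow> P n \<in> F \<and> P n dvd n \<and> \<not> (P n)\<^sup>2 dvd n" by metis
  define f where "f n = n div P n" for n
  have mult_eq: "P n * f n = n" if "n \<in> S" for n using P_spec[OF that] by (simp add: f_def)
  have not_dvd: "\<not> P n dvd f n" if "n \<in> S" for n
    using P_spec[OF that] mult_eq[OF that] by (metis mult_dvd_mono dvd_refl power2_eq_square)
  have not_less: "\<not> P n < P n'"
    if n_in_S: "n \<in> S" and n'_in_S: "n' \<in> S" and same_quotient: "f n = f n'" for n n'
  proof
    assume "P n < P n'"
    then have "(1 + \<eta>) * psi_ratio_upto y (P n' * f n) \<le> psi_ratio_upto y (P n * f n)"
      using F_primes P_spec[OF n_in_S] P_spec[OF n'_in_S] not_dvd[OF n_in_S] not_dvd[OF n'_in_S]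
        same_quotient
      by (intro psi_ratio_upto_prime_mult_separated separated) auto
    then show False
      using bounds(1)[OF n_in_S] bounds(2)[OF n'_in_S] mult_eq[OF n_in_S] mult_eq[OF n'_in_S] same_quotient
      by simp
  qed
  have "inj_on f S"
    using not_less mult_eq by (intro inj_onI) (metis linorder_neqE_nat)
  moreover have "0 < f n \<and> z * f n \<le> n" if "n \<in> S" for n
  proof
    have "n \<noteq> 0" using P_spec[OF that] by (metis dvd_0_right)
    then show "0 < f n" using mult_eq[OF that] by (auto intro: Nat.gr0I)
    have "z * f n \<le> P n * f n" using F_primes P_spec[OF that] by (simp add: less_imp_le)
    then show "z * f n \<le> n" using mult_eq[OF that] by simp
  qed
  ultimately have "density_at_most S (1 / real z)" using z_pos by (intro density_at_most_inj_quotient)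
  then show ?thesis by (simp add: S_def)
qed

lemma one_plus_inverse_separated:
  fixes p r w :: nat
  assumes "0 < p" "p < r" "r \<le> w"
  shows "(1 + 1 / (2 * (real w)\<^sup>2)) * (1 + 1 / real r) \<le> 1 + 1 / real p"
proof -
  have "1 / (2 * (real w)\<^sup>2) * (1 + 1 / real r) \<le> 1 / (2 * (real w)\<^sup>2) * 2"
    using assms by (intro mult_left_mono) auto
  also have "\<dots> = 1 / (real w * real w)" by (simp add: power2_eq_square)
  also have "\<dots> \<le> (real r - real p) / (real p * real r)"
    using assms by (intro frac_le mult_mono mult_pos_pos) auto
  also have "\<dots> = 1 / real p - 1 / real r" using assms by (simp add: field_simps)
  finally show ?thesis by (simp add: distrib_left distrib_right add_divide_distrib)
qed

lemma density_at_most_psi_ratio_upto_just_below: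
  assumes fin: "finite F" and F_primes: "\<And>p. p \<in> F \<Longrightarrow> prime p \<and> z < p \<and> p \<le> w" and "z > 0" "w \<le> y"
    and pos: "reciprocal_sum F > 0"
  shows "density_at_most (psi_ratio_upto_just_below (1 / (2 * (real w)\<^sup>2)) t y)
    (1 / real z + (1 / real z + 1 / reciprocal_sum F))"
proof -
  define \<eta> where "\<eta> = 1 / (2 * (real w)\<^sup>2)"
  let ?simple = "{n \<in> psi_ratio_upto_just_below \<eta> t y. \<exists>p\<in>F. p dvd n \<and> \<not> p\<^sup>2 dvd n}"
  let ?square = "{n::nat. \<exists>d>z. d\<^sup>2 dvd n}" and ?none = "{n. \<forall>p\<in>F. \<not> p dvd n}"
  have "density_at_most ?simple (1 / real z)"
  proof (rule density_at_most_just_below_simple_prime)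
    show "prime p \<and> z < p \<and> p \<le> y" if "p \<in> F" for p using F_primes[OF that] \<open>w \<le> y\<close> by simp
    show "(1 + \<eta>) * (1 + 1 / real r) \<le> 1 + 1 / real p" if "p \<in> F" "r \<in> F" "p < r" for p r
      unfolding \<eta>_def using F_primes[OF that(1)] F_primes[OF that(2)] that(3)
      by (intro one_plus_inverse_separated) auto
  qed fact
  moreover have "density_at_most ?square (1 / real z)" by (rule density_at_most_square_divisor) fact
  moreover have "density_at_most ?none (1 / reciprocal_sum F)"
    using fin F_primes pos by (intro density_at_most_no_prime_divisor_in) auto
  ultimately have "density_at_most (?simple \<union> (?square \<union> ?none))
      (1 / real z + (1 / real z + 1 / reciprocal_sum F))"
    by (intro density_at_most_Un)
  then show ?thesis
    unfolding \<eta>_def by (rule density_at_most_mono) (use F_primes in auto)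
qed

lemma psi_ratio_upto_not_concentrated:
  assumes "e > 0"
  obtains \<eta> w where "\<eta> > 0"
    "\<And>y. w \<le> y \<Longrightarrow> density_at_most (psi_ratio_upto_just_below \<eta> t y) e"
proof -
  have "3 / e > 0" using assms by simp
  moreover obtain z :: nat where z_gt: "3 / e < real z" using reals_Archimedean2 by blast
  ultimately have z_pos: "z > 0" by (cases "z = 0") auto
  obtain F where finite_F: "finite F"
    and F_primes: "\<And>p. p \<in> F \<Longrightarrow> prime p \<and> [p = 1] (mod 2) \<and> z < p"
    and F_sum: "3 / e \<le> reciprocal_sum F"
    using ex_primes_progression_sum_inverse_ge[of 2 1] by (metis two_is_prime_nat odd_one)
  have F_pos: "reciprocal_sum F > 0" using F_sum \<open>3 / e > 0\<close> by linarith
  have small: "1 / real z \<le> e / 3" "1 / reciprocal_sum F \<le> e / 3"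
    using z_gt F_sum z_pos F_pos assms by (simp_all add: field_simps)
  define w where "w = Max (insert 1 F)"
  have w_bounds: "w \<ge> 1" "\<And>p. p \<in> F \<Longrightarrow> p \<le> w" using finite_F by (auto simp: w_def)
  show ?thesis
  proof (rule that)
    show "1 / (2 * (real w)\<^sup>2) > 0" using w_bounds by simp
    fix y assume "w \<le> y"
    then have "density_at_most (psi_ratio_upto_just_below (1 / (2 * (real w)\<^sup>2)) t y)
        (1 / real z + (1 / real z + 1 / reciprocal_sum F))"
      using finite_F F_primes w_bounds z_pos F_pos
      by (intro density_at_most_psi_ratio_upto_just_below) auto
    then show "density_at_most (psi_ratio_upto_just_below (1 / (2 * (real w)\<^sup>2)) t y) e"
      by (rule density_at_most_mono) (use small in auto)
  qed
qed

lemma density_at_most_psi_ratio_crossing: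
  assumes "e > 0"
  obtains y where "density_at_most {n. psi_ratio_upto y n \<le> t \<and> t \<le> psi_ratio n} e"
proof -
  obtain \<eta> w where \<eta>_pos: "\<eta> > 0"
    and density_near: "\<And>y. w \<le> y \<Longrightarrow> density_at_most (psi_ratio_upto_just_below \<eta> t y) (e / 2)"
    using psi_ratio_upto_not_concentrated[of "e / 2" t] assms by (metis half_gt_zero)
  define \<theta> where "\<theta> = ln (1 + \<eta>)"
  have \<theta>_pos: "\<theta> > 0" and exp_\<theta>: "exp \<theta> = 1 + \<eta>" using \<eta>_pos by (simp_all add: \<theta>_def)
  define y where "y = max (max w 1) (nat \<lceil>2 / (e * \<theta>)\<rceil>)"
  have y_bounds: "y \<ge> w" "y > 0" by (auto simp: y_def)
  have "2 / (e * \<theta>) \<le> real y"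
    unfolding y_def by (metis max.cobounded2 of_nat_le_iff order_trans real_nat_ceiling_ge)
  then have tail_small: "1 / real y / \<theta> \<le> e / 2" using assms \<theta>_pos y_bounds by (simp add: field_simps)
  let ?near = "psi_ratio_upto_just_below \<eta> t y"
  let ?tail = "{n. \<theta> \<le> reciprocal_sum {p \<in> prime_factors n. y < p}}"
  have "t < (1 + \<eta>) * psi_ratio_upto y n" if n_crossing: "t \<le> psi_ratio n" "n \<notin> ?tail" for n
  proof -
    have "t \<le> psi_ratio_upto y n * exp (reciprocal_sum {p \<in> prime_factors n. y < p})"
      using n_crossing(1) psi_ratio_le_upto_mult_exp by (rule order_trans)
    also have "\<dots> < psi_ratio_upto y n * exp \<theta>"
      using n_crossing(2) psi_ratio_upto_pos[of y n] by (intro mult_strict_left_mono) auto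
    finally show ?thesis by (simp add: exp_\<theta> mult.commute)
  qed
  then have subset: "{n. psi_ratio_upto y n \<le> t \<and> t \<le> psi_ratio n} \<inter> {1..} \<subseteq> ?near \<union> ?tail"
    unfolding psi_ratio_upto_just_below_def by blast
  have "density_at_most (?near \<union> ?tail) (e / 2 + 1 / real y / \<theta>)"
    by (intro density_at_most_Un density_near density_at_most_large_prime_factors y_bounds \<theta>_pos)
  then have "density_at_most {n. psi_ratio_upto y n \<le> t \<and> t \<le> psi_ratio n} e"
    using subset by (rule density_at_most_mono) (use tail_small in simp)
  then show ?thesis by (rule that)
qed

section \<open>Cycles\<close>

lemma cycle_through_minimum:
  fixes f :: "nat \<Rightarrow> nat"
  assumes "l > 0" and cycle: "(f ^^ l) n = n"
  obtains m i where "i < l" "(f ^^ l) m = m" "m \<le> f m" "m \<le> n" "n = (f ^^ Suc i) m"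
proof -
  define m where "m = (LEAST v. \<exists>j. v = (f ^^ j) n)"
  have "\<exists>j. m = (f ^^ j) n" unfolding m_def by (rule LeastI_ex) blast
  then obtain j where "m = (f ^^ j) n" ..
  then have m_eq: "m = (f ^^ (j mod l)) n" using cycle by (simp add: funpow_mod_eq)
  have least: "m \<le> (f ^^ i) n" for i unfolding m_def by (rule Least_le) blast
  define i where "i = l - Suc (j mod l)"
  have i_bounds: "i < l" "Suc i + j mod l = l"
    using mod_less_divisor[OF \<open>l > 0\<close>, of j] by (auto simp: i_def)
  have "n = (f ^^ Suc i) m" unfolding m_eq using cycle i_bounds by (metis comp_apply funpow_add)
  moreover have "(f ^^ l) m = m"
    unfolding m_eq using cycle by (metis comp_apply funpow_add add.commute)
  moreover have "m \<le> f m" "m \<le> n" using least[of "Suc (j mod l)"] least[of 0] by (simp_all add: m_eq)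
  ultimately show ?thesis using that i_bounds(1) by blast
qed

lemma density_at_most_cycles:
  fixes f :: "nat \<Rightarrow> nat"
  assumes "l > 0" and minima: "density_at_most {n. (f ^^ l) n = n \<and> n \<le> f n} e"
  shows "density_at_most {n. (f ^^ l) n = n} (real l * e)"
proof -
  define M where "M = {n. (f ^^ l) n = n \<and> n \<le> f n}"
  obtain C where bound: "\<And>N. real (card (M \<inter> {1..N})) \<le> e * real N + C"
    using minima unfolding density_at_most_def M_def by blast
  show ?thesis
  proof (rule density_at_mostI)
    fix N
    have "{n. (f ^^ l) n = n} \<inter> {1..N} \<subseteq> (\<Union>i<l. (f ^^ Suc i) ` (M \<inter> {0..N}))"
    proof
      fix n assume n_cycle: "n \<in> {n. (f ^^ l) n = n} \<inter> {1..N}"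
      then obtain m i where "i < l" "(f ^^ l) m = m" "m \<le> f m" "m \<le> n" "n = (f ^^ Suc i) m"
        using cycle_through_minimum[OF \<open>l > 0\<close>, of f n] by blast
      moreover from this have "m \<in> M \<inter> {0..N}" using n_cycle by (auto simp: M_def)
      ultimately show "n \<in> (\<Union>i<l. (f ^^ Suc i) ` (M \<inter> {0..N}))" by blast
    qed
    then have "card ({n. (f ^^ l) n = n} \<inter> {1..N}) \<le> card (\<Union>i<l. (f ^^ Suc i) ` (M \<inter> {0..N}))"
      by (intro card_mono) auto
    also have "\<dots> \<le> (\<Sum>i<l. card ((f ^^ Suc i) ` (M \<inter> {0..N})))" by (rule card_UN_le) auto
    also have "\<dots> \<le> (\<Sum>i<l. Suc (card (M \<inter> {1..N})))"
    proof (rule sum_mono)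
      fix i
      have "card ((f ^^ Suc i) ` (M \<inter> {0..N})) \<le> card (M \<inter> {0..N})" by (rule card_image_le) simp
      also have "\<dots> \<le> card (insert 0 (M \<inter> {1..N}))" by (intro card_mono) auto
      finally show "card ((f ^^ Suc i) ` (M \<inter> {0..N})) \<le> Suc (card (M \<inter> {1..N}))" by simp
    qed
    finally have "real (card ({n. (f ^^ l) n = n} \<inter> {1..N})) \<le>
        real l * (real (card (M \<inter> {1..N})) + 1)"
      by (simp add: add.commute flip: of_nat_mult of_nat_Suc)
    also have "\<dots> \<le> real l * (e * real N + C + 1)" using bound[of N] by (intro mult_left_mono) auto
    also have "\<dots> = real l * e * real N + real l * (C + 1)" by (simp add: algebra_simps)
    finally show "real (card ({n. (f ^^ l) n = n} \<inter> {1..N})) \<le>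
        real l * e * real N + real l * (C + 1)" .
  qed
qed

lemma T_increases_along_orbit:
  assumes gt_2: "psi_ratio_upto y n > 2" and "n > 0"
    and persist: "\<And>j q. j \<le> l \<Longrightarrow> q \<le> y \<Longrightarrow> prime q \<Longrightarrow> q dvd n \<Longrightarrow> q dvd (T ^^ j) n"
  shows "n + l \<le> (T ^^ l) n"
proof -
  have "n + j \<le> (T ^^ j) n" if "j \<le> l" for j
    using that
  proof (induction j)
    case (Suc j)
    define m where "m = (T ^^ j) n"
    have m_ge: "n + j \<le> m" using Suc by (simp add: m_def)
    then have "psi_ratio_upto y n \<le> psi_ratio m"
      using persist[of j] Suc.prems \<open>n > 0\<close> by (intro psi_ratio_upto_le_psi_ratio) (auto simp: m_def)
    then have "real m * 1 < real m * (psi_ratio m - 1)"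
      using gt_2 m_ge \<open>n > 0\<close> by (intro mult_strict_left_mono) auto
    then have "m < T m" by (simp flip: T_eq_psi_ratio)
    then show ?case using m_ge by (simp add: m_def)
  qed simp
  then show ?thesis by blast
qed

lemma density_at_most_cycle_minima:
  assumes "l > 0" and "e > 0"
  shows "density_at_most {n. (T ^^ l) n = n \<and> n \<le> T n} e"
proof -
  obtain y where density_D: "density_at_most {n. psi_ratio_upto y n \<le> 2 \<and> 2 \<le> psi_ratio n} (e / 2)"
    (is "density_at_most ?D _")
    using density_at_most_psi_ratio_crossing[of "e / 2" 2] \<open>e > 0\<close> by auto
  obtain E where density_E: "density_at_most E (e / 2)"
    and persist: "\<And>n j q. n \<notin> E \<Longrightarrow> j \<le> l \<Longrightarrow> q \<le> y \<Longrightarrow> prime q \<Longrightarrow> q dvd n \<Longrightarrow> q dvd (T ^^ j) n"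
    using small_primes_persist[of "e / 2" l y] \<open>e > 0\<close> by auto
  have "density_at_most (?D \<union> E) (e / 2 + e / 2)" by (rule density_at_most_Un[OF density_D density_E])
  then show ?thesis
  proof (rule density_at_most_mono)
    show "{n. (T ^^ l) n = n \<and> n \<le> T n} \<inter> {1..} \<subseteq> ?D \<union> E"
    proof (rule subsetI, rule ccontr)
      fix n assume n_bad: "n \<in> {n. (T ^^ l) n = n \<and> n \<le> T n} \<inter> {1..}" "n \<notin> ?D \<union> E"
      then have "real n * 1 \<le> real n * (psi_ratio n - 1)" by (simp flip: T_eq_psi_ratio)
      then have "2 \<le> psi_ratio n" using n_bad(1) by simp
      then have "psi_ratio_upto y n > 2" using n_bad(2) by auto
      then have "n + l \<le> (T ^^ l) n" using n_bad by (intro T_increases_along_orbit persist) auto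
      then show False using n_bad(1) \<open>l > 0\<close> by simp
    qed
  qed simp
qed

lemma T_iter_eq_SomeD: "T_iter j n = Some m \<Longrightarrow> m = (T ^^ j) n"
  by (induction j arbitrary: m) (auto split: option.splits if_splits)

lemma density_at_most_T_iter_fixed_points:
  assumes "l > 0" and "e > 0"
  shows "density_at_most {n. T_iter l n = Some n} e"
proof (rule density_at_most_mono)
  show "density_at_most {n. (T ^^ l) n = n} (real l * (e / real l))"
    using assms by (intro density_at_most_cycles density_at_most_cycle_minima) auto
qed (use assms in \<open>auto dest!: T_iter_eq_SomeD[of l]\<close>)

lemma count_smallo_of_density_at_most:
  assumes "\<And>e. e > 0 \<Longrightarrow> density_at_most A e"
  shows "(\<lambda>x::real. real (card {n. 0 < n \<and> real n \<le> x \<and> n \<in> A})) \<in> o[at_top](\<lambda>x. x)"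
proof (rule landau_o.smallI)
  fix c :: real assume c_pos: "c > 0"
  obtain C where bound: "\<And>N. real (card (A \<inter> {1..N})) \<le> c / 2 * real N + C"
    using assms[of "c / 2"] c_pos unfolding density_at_most_def by auto
  show "eventually (\<lambda>x. norm (real (card {n. 0 < n \<and> real n \<le> x \<and> n \<in> A})) \<le> c * norm x) at_top"
    using eventually_ge_at_top[of "max 0 (2 * C / c)"]
  proof eventually_elim
    case (elim x)
    then have x_ge: "x \<ge> 0" "2 * C / c \<le> x" by auto
    have "{n. 0 < n \<and> real n \<le> x \<and> n \<in> A} = A \<inter> {1..nat \<lfloor>x\<rfloor>}"
      using x_ge by (auto simp: le_nat_floor le_nat_iff le_floor_iff Suc_le_eq)
    then have "real (card {n. 0 < n \<and> real n \<le> x \<and> n \<in> A}) \<le> c / 2 * real (nat \<lfloor>x\<rfloor>) + C"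
      using bound by simp
    also have "\<dots> \<le> c / 2 * x + C" using c_pos x_ge by (intro add_right_mono mult_left_mono) auto
    also have "\<dots> \<le> c * x" using x_ge c_pos by (simp add: field_simps)
    finally show ?case using x_ge by simp
  qed
qed

lemma T_iter_exact_period:
  assumes "periodic_point n"
  shows "T_iter (exact_period n) n = Some n"
proof -
  have "\<exists>r. r > 0 \<and> T_iter r n = Some n" using assms by (auto simp: periodic_point_def)
  then have "exact_period n > 0 \<and> T_iter (exact_period n) n = Some n"
    unfolding exact_period_def by (rule LeastI_ex)
  then show ?thesis ..
qed

theorem corollary1:
  fixes l :: nat
  assumes "l > 0"
  shows "(\<lambda>x::real. real (card {n::nat. 0 < n \<and> real n \<le> x \<and> T_iter l n = Some n})) \<in> o[at_top](\<lambda>x. x)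
       \<and> has_asymptotic_density {n. periodic_point n \<and> exact_period n = l} 0"
proof
  have fixed: "density_at_most {n. T_iter l n = Some n} e" if "e > 0" for e
    using assms that by (rule density_at_most_T_iter_fixed_points)
  then show "(\<lambda>x::real. real (card {n. 0 < n \<and> real n \<le> x \<and> T_iter l n = Some n})) \<in> o[at_top](\<lambda>x. x)"
    using count_smallo_of_density_at_most[of "{n. T_iter l n = Some n}"] by simp
  have "density_at_most {n. periodic_point n \<and> exact_period n = l} e" if "e > 0" for e
    using fixed[OF that] by (rule density_at_most_mono) (auto dest: T_iter_exact_period)
  then show "has_asymptotic_density {n. periodic_point n \<and> exact_period n = l} 0"
    unfolding has_asymptotic_density_def by (intro smalloD_tendsto count_smallo_of_density_at_most)
qed

end
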